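(* Let $0<|q|<1$ and let $\mu,\nu,\beta$ be complex numbers. For a complex number $\lambda$ define \[ F_\lambda(z;\beta\,|\,q)=\sum_{k\geqslant 0}\frac{(\beta;q)_k\,(\beta;q)_{\lambda-k}}{(q;q)_k\,(q;q)_{\lambda-k}}\,z^{2k}. \] Then, as an identity of power series in $z$, valid for $|qz^2/\beta|<1$, \begin{align*} F_\mu(z;\beta\,|\,q)\,F_\nu(z;\beta\,|\,q) &=\sum_{k\geqslant 0} \frac{(q;q)_{\mu+\nu-2k}\,(\beta;q)_{\mu-k}\,(\beta;q)_{\nu-k}\,(\beta;q)_k\, (\beta^2;q)_{\mu+\nu-k}} {(\beta^2;q)_{\mu+\nu-2k}\,(q;q)_{\mu-k}\,(q;q)_{\nu-k}\,(q;q)_k\, (q\beta;q)_{\mu+\nu-k}}\\ &\qquad\times\frac{1-\beta q^{\mu+\nu-2k}}{1-\beta}\,z^{2k}\, F_{\mu+\nu-2k}(z;\beta\,|\,q). \end{align*}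
   Context: For complex $x$, $0<|q|<1$ and any complex number $\lambda$, the $q$-shifted factorial is $(x;q)_\lambda=(x;q)_\infty/(xq^\lambda;q)_\infty$, where $(x;q)_\infty=\prod_{j\ge0}(1-xq^j)$; for a nonnegative integer $\lambda=k$ this is $\prod_{j=0}^{k-1}(1-xq^j)$. *)

theory Defs
  imports
    "HOL-Analysis.Analysis"
    "HOL-Computational_Algebra.Formal_Power_Series"
begin

definition qinf :: "complex \<Rightarrow> complex \<Rightarrow> complex" where
  "qinf x q = (\<Prod>j. 1 - x * q ^ j)"

(* (x;q)_l for complex l.  The power q^l is taken with the principal logarithm.  Since
   only q^l and integer shifts of l matter, another branch of log q amounts to replacing l by
   l * c for a constant c, before the integer shifts.
   For l a natural number the finite product is used, which agrees with the quotient
   whenever the quotient is not 0/0. *)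
definition qfac :: "complex \<Rightarrow> complex \<Rightarrow> complex \<Rightarrow> complex" where
  "qfac x q l =
     (if l \<in> \<nat> then (\<Prod>j<nat \<lfloor>Re l\<rfloor>. 1 - x * q ^ j)
      else qinf x q / qinf (x * q powr l) q)"

(* (x;q)_l is finite, i.e. l is not a pole. *)
definition qfac_finite :: "complex \<Rightarrow> complex \<Rightarrow> complex \<Rightarrow> bool" where
  "qfac_finite x q l \<longleftrightarrow> l \<in> \<nat> \<or> qinf (x * q powr l) q \<noteq> 0"

(* 1/(x;q)_l is finite; for l not in Nats it is (x q^l;q)_inf / (x;q)_inf.
   At a pole of (x;q)_l the reciprocal is 0, which is also the value that division by zero
   assigns to it.  In particular 1/(q;q)_l = 0 for l = -1, -2, ..., as usual. *)
definition qfac_recip_finite :: "complex \<Rightarrow> complex \<Rightarrow> complex \<Rightarrow> bool" where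
  "qfac_recip_finite x q l \<longleftrightarrow> (if l \<in> \<nat> then qfac x q l \<noteq> 0 else qinf x q \<noteq> 0)"

(* Indices k that contribute to a sum containing the factor 1/(q;q)_(l-k):
   all k if l is not a natural number, and k \<le> l otherwise, the remaining terms being 0. *)
definition qrange :: "complex \<Rightarrow> nat set" where
  "qrange l = {k. l \<in> \<nat> \<longrightarrow> l - of_nat k \<in> \<nat>}"

definition F_coeff :: "complex \<Rightarrow> complex \<Rightarrow> complex \<Rightarrow> nat \<Rightarrow> complex" where
  "F_coeff l \<beta> q k =
     (qfac \<beta> q (of_nat k) * qfac \<beta> q (l - of_nat k)) /
     (qfac q q (of_nat k) * qfac q q (l - of_nat k))"

definition F_defined :: "complex \<Rightarrow> complex \<Rightarrow> complex \<Rightarrow> bool" where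
  "F_defined l \<beta> q \<longleftrightarrow> (\<forall>k\<in>qrange l. qfac_finite \<beta> q (l - of_nat k))"

definition F :: "complex \<Rightarrow> complex \<Rightarrow> complex \<Rightarrow> complex \<Rightarrow> complex" where
  "F l z \<beta> q = (\<Sum>k. F_coeff l \<beta> q k * z ^ (2 * k))"

definition F_summable :: "complex \<Rightarrow> complex \<Rightarrow> complex \<Rightarrow> complex \<Rightarrow> bool" where
  "F_summable l z \<beta> q \<longleftrightarrow> summable (\<lambda>k. norm (F_coeff l \<beta> q k * z ^ (2 * k)))"

(* F_l as a formal power series in z. *)
definition F_fps :: "complex \<Rightarrow> complex \<Rightarrow> complex \<Rightarrow> complex fps" where
  "F_fps l \<beta> q = Abs_fps (\<lambda>n. if even n then F_coeff l \<beta> q (n div 2) else 0)"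

definition lin_coeff :: "complex \<Rightarrow> complex \<Rightarrow> complex \<Rightarrow> complex \<Rightarrow> nat \<Rightarrow> complex" where
  "lin_coeff \<mu> \<nu> \<beta> q k =
     (qfac q q (\<mu> + \<nu> - 2 * of_nat k) * qfac \<beta> q (\<mu> - of_nat k) * qfac \<beta> q (\<nu> - of_nat k) *
      qfac \<beta> q (of_nat k) * qfac (\<beta>\<^sup>2) q (\<mu> + \<nu> - of_nat k)) /
     (qfac (\<beta>\<^sup>2) q (\<mu> + \<nu> - 2 * of_nat k) * qfac q q (\<mu> - of_nat k) * qfac q q (\<nu> - of_nat k) *
      qfac q q (of_nat k) * qfac (q * \<beta>) q (\<mu> + \<nu> - of_nat k)) *
     ((1 - \<beta> * q powr (\<mu> + \<nu> - 2 * of_nat k)) / (1 - \<beta>))"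

(* All expressions in the contributing terms of the product formula are meaningful:
   no shifted factorial in a numerator has a pole, and none in a denominator vanishes. *)
definition lin_defined :: "complex \<Rightarrow> complex \<Rightarrow> complex \<Rightarrow> complex \<Rightarrow> bool" where
  "lin_defined \<mu> \<nu> \<beta> q \<longleftrightarrow>
     \<beta> \<noteq> 1 \<and> F_defined \<mu> \<beta> q \<and> F_defined \<nu> \<beta> q \<and>
     (\<forall>k \<in> qrange \<mu> \<inter> qrange \<nu>.
        F_defined (\<mu> + \<nu> - 2 * of_nat k) \<beta> q \<and>
        qfac_finite q q (\<mu> + \<nu> - 2 * of_nat k) \<and>
        qfac_finite (\<beta>\<^sup>2) q (\<mu> + \<nu> - of_nat k) \<and>
        qfac_recip_finite (\<beta>\<^sup>2) q (\<mu> + \<nu> - 2 * of_nat k) \<and>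
        qfac_recip_finite (q * \<beta>) q (\<mu> + \<nu> - of_nat k))"

end

theory Submission
  imports Defs
begin

text \<open>
  Write \<open>A = q\<^sup>\<lambda>\<close>.  After division by its constant coefficient, the series \<open>F\<^sub>\<lambda>\<close> becomes a
  series \<open>G\<^sub>A\<close> whose coefficients are rational in \<open>A\<close>, and the product formula becomes
  \<open>G\<^sub>a G\<^sub>b = \<Sum>\<^sub>k l\<^sub>k(a, b) w\<^sup>k G\<^sub>C\<^sub>k\<close> with \<open>w = z\<^sup>2\<close> and \<open>C\<^sub>k = a b / q\<^sup>2\<^sup>k\<close>.  The three-term
  recurrence \<open>G\<^sub>q\<^sub>a = (1 + w) G\<^sub>a - w h(a) G\<^sub>a\<^sub>/\<^sub>q\<close> and a matching recurrence for \<open>l\<^sub>k\<close> show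
  that the difference \<open>E(a)\<close> of the two sides obeys \<open>E(q a) = (1 + w) E(a) - w h(a) E(a/q)\<close>.
  By induction on \<open>n\<close>, if the coefficient of \<open>w\<^sup>n\<close> in \<open>E\<close> vanishes identically, then the coefficient of
  \<open>w\<^sup>n\<^sup>+\<^sup>1\<close> is invariant under \<open>a \<mapsto> q a\<close>, hence equal to its limit at \<open>a = 0\<close>, hence to its value
  at \<open>a = 1\<close>, which is \<open>0\<close>.  This requires \<open>\<beta>\<close> to avoid countably many values; the
  remaining \<open>\<beta>\<close> follow by continuity of the nonvanishing terms.  For the identity of functions,
  the term of the double series with indices \<open>k, m\<close> is \<open>O(|q w / \<beta>|\<^sup>k\<^sup>+\<^sup>m)\<close>, so it may be
  rearranged.
\<close>

subsection \<open>Recurrences of the normalised coefficients\<close>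

definition qbin :: "complex \<Rightarrow> complex \<Rightarrow> nat \<Rightarrow> complex" where
  "qbin \<beta> q n = (\<Prod>j<n. (1 - \<beta> * q ^ j) / (1 - q ^ Suc j))"

text \<open>
  For \<open>A = q\<^sup>\<lambda>\<close> this is \<open>(\<beta>;q)\<^sub>\<lambda>\<^sub>-\<^sub>n (q;q)\<^sub>\<lambda> / ((q;q)\<^sub>\<lambda>\<^sub>-\<^sub>n (\<beta>;q)\<^sub>\<lambda>)\<close>.
\<close>

definition qdesc :: "complex \<Rightarrow> complex \<Rightarrow> complex \<Rightarrow> nat \<Rightarrow> complex" where
  "qdesc \<beta> q A n = (\<Prod>j<n. (1 - A / q ^ j) / (1 - \<beta> * A / q ^ Suc j))"

text \<open>
  For \<open>C = q\<^sup>M\<close> this is \<open>(\<beta>\<^sup>2;q)\<^sub>M\<^sub>-\<^sub>k (q\<beta>;q)\<^sub>M\<^sub>-\<^sub>2\<^sub>k / ((\<beta>\<^sup>2;q)\<^sub>M\<^sub>-\<^sub>2\<^sub>k (q\<beta>;q)\<^sub>M\<^sub>-\<^sub>k)\<close>.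
\<close>

definition qmid :: "complex \<Rightarrow> complex \<Rightarrow> complex \<Rightarrow> nat \<Rightarrow> complex" where
  "qmid \<beta> q C k = (\<Prod>e=k..<2*k. (1 - \<beta>\<^sup>2 * C / q ^ Suc e) / (1 - \<beta> * C / q ^ e))"

text \<open>With A = q^l this is \<open>F_coeff l \<beta> q n\<close> divided by
  \<open>F_coeff l \<beta> q 0\<close>, so a shift of l by 1 becomes multiplication of A by
  q.\<close>

definition Gcoeff :: "complex \<Rightarrow> complex \<Rightarrow> complex \<Rightarrow> nat \<Rightarrow> complex" where
  "Gcoeff \<beta> q A n = qbin \<beta> q n * qdesc \<beta> q A n"

text \<open>With a = q^\<mu> and b = q^\<nu> this is \<open>lin_coeff\<close> multiplied by the
  constant coefficient of F_(\<mu>+\<nu>-2k) and divided by those of F_\<mu> and F_\<nu>; the factor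
  (q;q)_(\<mu>+\<nu>-2k) has cancelled.\<close>

definition Lcoeff :: "complex \<Rightarrow> complex \<Rightarrow> complex \<Rightarrow> complex \<Rightarrow> nat \<Rightarrow> complex" where
  "Lcoeff \<beta> q a b k = qbin \<beta> q k * qdesc \<beta> q a k * qdesc \<beta> q b k * qmid \<beta> q (a * b) k"

text \<open>The coefficient in the three-term recurrence of the continuous q-ultraspherical (Rogers)
  polynomials, after each is divided by its constant coefficient in w.\<close>

definition hcoeff :: "complex \<Rightarrow> complex \<Rightarrow> complex \<Rightarrow> complex" where
  "hcoeff \<beta> q A = (1 - \<beta>\<^sup>2 * A / q) * (1 - A) / ((1 - \<beta> * A) * (1 - \<beta> * A / q))"

text \<open>No factor \<open>1 - x q\<^sup>i\<close> with \<open>i\<close> an integer vanishes.\<close>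

definition generic :: "complex \<Rightarrow> complex \<Rightarrow> bool" where
  "generic q x \<longleftrightarrow> (\<forall>m n. x * q ^ m \<noteq> q ^ n)"

text \<open>
  In the next two identities \<open>\<gamma> = \<beta>/q\<close>, \<open>X = q\<^sup>n\<^sup>+\<^sup>1\<close>, \<open>A = a/q\<^sup>n\<close> and \<open>B = b/q\<^sup>n\<close>; this
  substitution reduces the recurrences to rational identities in three and four variables.
\<close>

lemma G_identity:
  fixes X \<gamma> A :: complex
  assumes "X \<noteq> 1" "\<gamma> * A * X \<noteq> 1" "\<gamma> * A \<noteq> 1"
  shows "(1 - \<gamma> * X) / (1 - X) * ((1 - A * X) / (1 - \<gamma> * A * X)) =
    (1 - \<gamma> * X) / (1 - X) * ((1 - A) / (1 - \<gamma> * A)) + 1 -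
    (1 - \<gamma>\<^sup>2 * A * X) * (1 - A) / ((1 - \<gamma> * A * X) * (1 - \<gamma> * A))"
proof -
  have *: "1 - X \<noteq> 0" "1 - \<gamma> * A * X \<noteq> 0" "1 - \<gamma> * A \<noteq> 0"
    using assms by auto
  show ?thesis
    using * by (simp add: divide_simps) algebra
qed

lemma L_identity:
  fixes X \<gamma> A B :: complex
  assumes "X \<noteq> 1" "\<gamma> * A * X \<noteq> 1" "\<gamma> * A \<noteq> 1" "\<gamma> * B \<noteq> 1" "\<gamma>\<^sup>2 * (A * B * X) \<noteq> 1" "\<gamma> * (A * B) \<noteq> 1"
  shows "(1 - \<gamma> * X) / (1 - X) * ((1 - A * X) / (1 - \<gamma> * A * X)) * ((1 - B) / (1 - \<gamma> * B)) =
    (1 - \<gamma> * X) / (1 - X) * ((1 - A) / (1 - \<gamma> * A)) * ((1 - B) / (1 - \<gamma> * B)) *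
      ((1 - \<gamma>\<^sup>2 * (A * B)) * (1 - \<gamma> * (A * B * X)) / ((1 - \<gamma>\<^sup>2 * (A * B * X)) * (1 - \<gamma> * (A * B)))) +
    (1 - A * B) / (1 - \<gamma> * (A * B)) -
    (1 - \<gamma>\<^sup>2 * A * X) * (1 - A) / ((1 - \<gamma> * A * X) * (1 - \<gamma> * A)) *
      ((1 - \<gamma> * (A * B * X)) / (1 - \<gamma>\<^sup>2 * (A * B * X)))"
proof -
  have *: "1 - X \<noteq> 0" "1 - \<gamma> * A * X \<noteq> 0" "1 - \<gamma> * A \<noteq> 0" "1 - \<gamma> * B \<noteq> 0"
    "1 - \<gamma>\<^sup>2 * (A * B * X) \<noteq> 0" "1 - \<gamma> * (A * B) \<noteq> 0"
    using assms by auto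
  show ?thesis
    using * by (simp add: divide_simps) algebra
qed

lemma genericD:
  assumes "generic q x" "q \<noteq> 0"
  shows "x * q ^ n \<noteq> 1" "x / q ^ n \<noteq> 1" "x \<noteq> 1"
proof -
  show 1: "x * q ^ n \<noteq> 1" for n
    using assms unfolding generic_def by (metis power_0)
  show "x / q ^ n \<noteq> 1"
    using assms unfolding generic_def by (metis divide_eq_1_iff power_0 mult.right_neutral)
  show "x \<noteq> 1" using 1[of 0] by simp
qed

lemma generic_mult:
  assumes "generic q x" "q \<noteq> 0"
  shows "generic q (x * q ^ k)" "generic q (x / q ^ k)"
proof -
  show "generic q (x * q ^ k)"
    using assms unfolding generic_def by (metis mult.assoc power_add)
  show "generic q (x / q ^ k)"
    unfolding generic_def
  proof (intro allI notI)
    fix m n assume "x / q ^ k * q ^ m = q ^ n"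
    then have "x * q ^ m = q ^ (n + k)"
      using assms by (simp add: field_simps power_add)
    then show False using assms(1) by (auto simp: generic_def)
  qed
qed

lemma qbin_Suc: "qbin \<beta> q (Suc n) = qbin \<beta> q n * ((1 - \<beta> * q ^ n) / (1 - q ^ Suc n))"
  by (simp add: qbin_def)

lemma qdesc_Suc: "qdesc \<beta> q A (Suc n) = qdesc \<beta> q A n * ((1 - A / q ^ n) / (1 - \<beta> * A / q ^ Suc n))"
  by (simp add: qdesc_def)

lemma qdesc_shift_up:
  assumes "q \<noteq> 0"
  shows "qdesc \<beta> q (q * A) (Suc n) = (1 - q * A) / (1 - \<beta> * A) * qdesc \<beta> q A n"
  unfolding qdesc_def by (subst prod.lessThan_Suc_shift) (use assms in simp)

text \<open>Splitting off the first or the last factor of \<open>qdesc \<beta> q A (Suc n)\<close>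
  gives two expressions for it. The equation is kept free of denominators because 1 - A may
  vanish.\<close>

lemma qdesc_shift_down:
  assumes "q \<noteq> 0" "generic q (\<beta> * A)"
  shows "(1 - A) * qdesc \<beta> q (A / q) n * (1 - \<beta> * A / q ^ Suc n) =
    qdesc \<beta> q A n * (1 - A / q ^ n) * (1 - \<beta> * A / q)"
proof -
  have "qdesc \<beta> q A (Suc n) = (1 - A) / (1 - \<beta> * A / q) * qdesc \<beta> q (A / q) n"
    using qdesc_shift_up[of q \<beta> "A/q" n] assms by simp
  moreover have "1 - \<beta> * A / q \<noteq> 0" "1 - \<beta> * A / q ^ Suc n \<noteq> 0"
    using genericD(2)[OF assms(2,1), of 1] genericD(2)[OF assms(2,1), of "Suc n"] by auto
  ultimately show ?thesis
    unfolding qdesc_Suc by (simp add: divide_simps mult_ac split: if_splits)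
qed

text \<open>The factor 1 - A in the numerator of \<open>hcoeff\<close> is exactly what
  \<open>qdesc_shift_down\<close> asks for, so the shifted product can be expressed by the unshifted
  one even at A = 1.\<close>

lemma hcoeff_qdesc:
  assumes "q \<noteq> 0" "generic q (\<beta> * A)"
  shows "hcoeff \<beta> q A * qdesc \<beta> q (A / q) n = qdesc \<beta> q A n *
     ((1 - \<beta>\<^sup>2 * A / q) * (1 - A / q ^ n) / ((1 - \<beta> * A) * (1 - \<beta> * A / q ^ Suc n)))"
proof -
  have "1 - \<beta> * A / q \<noteq> 0" "1 - \<beta> * A / q ^ Suc n \<noteq> 0" "1 - \<beta> * A \<noteq> 0"
    using genericD(2)[OF assms(2,1), of 1] genericD(2)[OF assms(2,1), of "Suc n"] genericD(3)[OF assms(2,1)] by auto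
  moreover have cancel: "x * (y * z * w) / (u * w * v) = y * (x * z / (u * v))" if "w \<noteq> 0"
    for u v w x y z :: complex
    using that by simp
  ultimately have "hcoeff \<beta> q A * qdesc \<beta> q (A / q) n = (1 - \<beta>\<^sup>2 * A / q) *
     ((1 - A) * qdesc \<beta> q (A / q) n * (1 - \<beta> * A / q ^ Suc n)) /
     ((1 - \<beta> * A) * (1 - \<beta> * A / q) * (1 - \<beta> * A / q ^ Suc n))"
    using assms(1) by (simp add: hcoeff_def)
  also have "\<dots> = (1 - \<beta>\<^sup>2 * A / q) * (qdesc \<beta> q A n * (1 - A / q ^ n) * (1 - \<beta> * A / q)) /
     ((1 - \<beta> * A) * (1 - \<beta> * A / q) * (1 - \<beta> * A / q ^ Suc n))"
    by (simp only: qdesc_shift_down[OF assms])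
  also have "\<dots> = qdesc \<beta> q A n *
     ((1 - \<beta>\<^sup>2 * A / q) * (1 - A / q ^ n) / ((1 - \<beta> * A) * (1 - \<beta> * A / q ^ Suc n)))"
    by (rule cancel) fact
  finally show ?thesis .
qed

text \<open>All four terms share the factor \<open>qbin \<beta> q n * qdesc \<beta> q A n\<close>;
  what remains is \<open>G_identity\<close>.\<close>

lemma Gcoeff_rec:
  assumes "q \<noteq> 0" "generic q (\<beta> * A)" "\<And>n. q ^ Suc n \<noteq> 1"
  shows "Gcoeff \<beta> q (q * A) (Suc n) =
    Gcoeff \<beta> q A (Suc n) + Gcoeff \<beta> q A n - hcoeff \<beta> q A * Gcoeff \<beta> q (A / q) n"
proof -
  let ?X = "q ^ Suc n" and ?g = "\<beta> / q" and ?A = "A / q ^ n"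
  let ?c = "qbin \<beta> q n * qdesc \<beta> q A n"
  have e: "?g * ?X = \<beta> * q ^ n" "?A * ?X = q * A" "?g * ?A = \<beta> * A / q ^ Suc n"
    "\<beta> * A / q ^ Suc n * ?X = \<beta> * A" "?g\<^sup>2 * ?A * ?X = \<beta>\<^sup>2 * A / q"
    using assms(1) by (auto simp: power2_eq_square)
  have "?g * ?A * ?X \<noteq> 1" "?g * ?A \<noteq> 1"
    unfolding e using genericD[OF assms(2,1)] by blast+
  note id = G_identity[OF assms(3) this, unfolded e]
  have "Gcoeff \<beta> q (q * A) (Suc n) = ?c * ((1 - \<beta> * q ^ n) / (1 - q ^ Suc n) * ((1 - q * A) / (1 - \<beta> * A)))"
    unfolding Gcoeff_def qbin_Suc qdesc_shift_up[OF assms(1)] by (simp only: mult_ac)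
  moreover have "Gcoeff \<beta> q A (Suc n) = ?c * ((1 - \<beta> * q ^ n) / (1 - q ^ Suc n) * ((1 - A / q ^ n) / (1 - \<beta> * A / q ^ Suc n)))"
    unfolding Gcoeff_def qbin_Suc qdesc_Suc by (simp only: mult_ac)
  moreover have "hcoeff \<beta> q A * Gcoeff \<beta> q (A / q) n = ?c * ((1 - \<beta>\<^sup>2 * A / q) * (1 - A / q ^ n) / ((1 - \<beta> * A) * (1 - \<beta> * A / q ^ Suc n)))"
    using hcoeff_qdesc[OF assms(1,2), of n] unfolding Gcoeff_def by (metis mult.left_commute mult.assoc)
  moreover have "Gcoeff \<beta> q A n = ?c * 1" by (simp add: Gcoeff_def)
  ultimately show ?thesis
    unfolding id by (simp only: right_diff_distrib distrib_left)
qed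

text \<open>After reindexing, the three products run over n..2n, n+1..2n and n+1..2n+1 with the same
  factors, while \<open>qmid \<beta> q C n\<close> runs over n..2n-1. They differ only at the ends,
  and T is the factor at 2n.\<close>

lemma qmid_ratios:
  fixes \<beta> C q :: complex and n :: nat
  assumes "q \<noteq> 0" "generic q (\<beta> * C)" "generic q (\<beta>\<^sup>2 * C)"
  defines "T \<equiv> (1 - \<beta>\<^sup>2 * C / q ^ Suc (2*n)) / (1 - \<beta> * C / q ^ (2*n))"
  shows "qmid \<beta> q (q * C) (Suc n) = qmid \<beta> q C n * T"
    and "qmid \<beta> q (C / q) n = qmid \<beta> q C n * T *
       ((1 - \<beta> * C / q ^ n) / (1 - \<beta>\<^sup>2 * C / q ^ Suc n))"
    and "qmid \<beta> q C (Suc n) = qmid \<beta> q C n * T *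
      ((1 - \<beta>\<^sup>2 * C / q ^ Suc (Suc (2*n))) * (1 - \<beta> * C / q ^ n) /
      ((1 - \<beta>\<^sup>2 * C / q ^ Suc n) * (1 - \<beta> * C / q ^ Suc (2*n))))"
proof -
  let ?s = "\<lambda>e. (1 - \<beta>\<^sup>2 * C / q ^ Suc e) / (1 - \<beta> * C / q ^ e)"
  have nz: "1 - \<beta> * C / q ^ e \<noteq> 0" "1 - \<beta>\<^sup>2 * C / q ^ e \<noteq> 0" for e
    using genericD(2)[OF assms(2,1), of e] genericD(2)[OF assms(3,1), of e] by auto
  have sh: "{Suc n..<2 * Suc n} = Suc ` {n..<Suc (2*n)}" by simp
  have eq: "prod ?s {n..<Suc (2*n)} = qmid \<beta> q C n * T"
    by (simp add: qmid_def T_def)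
  have "qmid \<beta> q (q * C) (Suc n) = prod ?s {n..<Suc (2*n)}"
    unfolding qmid_def sh using assms(1)
    by (subst prod.reindex) (auto intro!: prod.cong)
  then show "qmid \<beta> q (q * C) (Suc n) = qmid \<beta> q C n * T" using eq by simp
  have s2: "prod ?s {n..<Suc (2*n)} = ?s n * prod ?s {Suc n..<Suc (2*n)}"
    by (rule prod.atLeast_Suc_lessThan) simp
  have s3: "prod ?s {Suc n..<Suc (2*n)} = qmid \<beta> q C n * T * ((1 - \<beta> * C / q ^ n) / (1 - \<beta>\<^sup>2 * C / q ^ Suc n))"
    using s2 eq nz(1)[of n] nz(2)[of "Suc n"] by (simp add: field_simps)
  have "qmid \<beta> q (C / q) n = prod ?s (Suc ` {n..<2*n})"
    unfolding qmid_def by (subst prod.reindex) (auto intro!: prod.cong simp: mult_ac)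
  also have "Suc ` {n..<2*n} = {Suc n..<Suc (2*n)}" by simp
  finally show "qmid \<beta> q (C / q) n = qmid \<beta> q C n * T *
       ((1 - \<beta> * C / q ^ n) / (1 - \<beta>\<^sup>2 * C / q ^ Suc n))"
    using s3 by simp
  have "qmid \<beta> q C (Suc n) = prod ?s {Suc n..<Suc (2*n)} * ?s (Suc (2*n))"
    unfolding qmid_def by (simp add: prod.atLeastLessThan_Suc)
  then show "qmid \<beta> q C (Suc n) = qmid \<beta> q C n * T *
      ((1 - \<beta>\<^sup>2 * C / q ^ Suc (Suc (2*n))) * (1 - \<beta> * C / q ^ n) /
      ((1 - \<beta>\<^sup>2 * C / q ^ Suc n) * (1 - \<beta> * C / q ^ Suc (2*n))))"
    unfolding s3 by (simp add: mult_ac)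
qed

text \<open>This makes the right side of the product formula obey the recurrence of the left side:
  applying \<open>Gcoeff_rec\<close> at C_k produces h(C_k), and the middle term here compensates it
  at index k + 1.\<close>

lemma Lcoeff_rec:
  assumes "q \<noteq> 0" "generic q (\<beta> * a)" "generic q (\<beta> * b)"
     "generic q (\<beta> * (a * b))" "generic q (\<beta>\<^sup>2 * (a * b))" "\<And>n. q ^ Suc n \<noteq> 1"
  shows "Lcoeff \<beta> q (q * a) b (Suc n) =
    Lcoeff \<beta> q a b (Suc n) + Lcoeff \<beta> q a b n * hcoeff \<beta> q (a * b / q ^ (2 * n))
      - hcoeff \<beta> q a * Lcoeff \<beta> q (a / q) b n"
proof -
  let ?X = "q ^ Suc n" and ?g = "\<beta> / q" and ?A = "a / q ^ n" and ?B = "b / q ^ n"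
  let ?C = "a * b"
  define T where "T \<equiv> (1 - \<beta>\<^sup>2 * ?C / q ^ Suc (2*n)) / (1 - \<beta> * ?C / q ^ (2*n))"
  define c where "c = qbin \<beta> q n * qdesc \<beta> q a n * qdesc \<beta> q b n * (qmid \<beta> q ?C n * T)"
  note mid = qmid_ratios[OF assms(1,4,5), of n, folded T_def]
  have e: "?g * ?X = \<beta> * q ^ n" "?A * ?X = q * a" "?g * ?A = \<beta> * a / q ^ Suc n"
    "\<beta> * a / q ^ Suc n * ?X = \<beta> * a" "?g\<^sup>2 * ?A * ?X = \<beta>\<^sup>2 * a / q"
    "?g * ?B = \<beta> * b / q ^ Suc n" "?A * ?B = ?C / q ^ (2*n)"
    "?g\<^sup>2 * (?C / q ^ (2*n)) = \<beta>\<^sup>2 * ?C / q ^ Suc (Suc (2*n))"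
    "?g * (?C / q ^ (2*n)) = \<beta> * ?C / q ^ Suc (2*n)"
    "?g * (?C / q ^ (2*n) * ?X) = \<beta> * ?C / q ^ n"
    "?g\<^sup>2 * (?C / q ^ (2*n) * ?X) = \<beta>\<^sup>2 * ?C / q ^ Suc n"
    using assms(1) by (auto simp: power2_eq_square mult_2 power_add)
  have nz: "?g * ?A * ?X \<noteq> 1" "?g * ?A \<noteq> 1" "?g * ?B \<noteq> 1" "?g\<^sup>2 * (?A * ?B * ?X) \<noteq> 1" "?g * (?A * ?B) \<noteq> 1"
    unfolding e using genericD[OF assms(2,1)] genericD[OF assms(3,1)] genericD[OF assms(4,1)]
     genericD[OF assms(5,1)] by blast+
  note id = L_identity[OF assms(6) nz, unfolded e]
  have h: "hcoeff \<beta> q (?C / q ^ (2*n)) = T * ((1 - ?C / q ^ (2*n)) / (1 - \<beta> * ?C / q ^ Suc (2*n)))"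
    unfolding hcoeff_def T_def by (simp add: mult_ac)
  have 1: "Lcoeff \<beta> q (q * a) b (Suc n) = c *
    ((1 - \<beta> * q ^ n) / (1 - q ^ Suc n) * ((1 - q * a) / (1 - \<beta> * a)) * ((1 - b / q ^ n) / (1 - \<beta> * b / q ^ Suc n)))"
    unfolding Lcoeff_def qbin_Suc qdesc_shift_up[OF assms(1)] qdesc_Suc[of _ _ b] mult.assoc[of q] mid(1) c_def
    by (simp only: mult_ac)
  have 2: "Lcoeff \<beta> q a b (Suc n) = c *
    ((1 - \<beta> * q ^ n) / (1 - q ^ Suc n) * ((1 - a / q ^ n) / (1 - \<beta> * a / q ^ Suc n)) *
     ((1 - b / q ^ n) / (1 - \<beta> * b / q ^ Suc n)) *
     ((1 - \<beta>\<^sup>2 * ?C / q ^ Suc (Suc (2*n))) * (1 - \<beta> * ?C / q ^ n) /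
      ((1 - \<beta>\<^sup>2 * ?C / q ^ Suc n) * (1 - \<beta> * ?C / q ^ Suc (2*n)))))"
    unfolding Lcoeff_def qbin_Suc qdesc_Suc mid(3) c_def by (simp only: mult_ac)
  have 3: "Lcoeff \<beta> q a b n * hcoeff \<beta> q (a * b / q ^ (2 * n)) =
     c * ((1 - ?C / q ^ (2*n)) / (1 - \<beta> * ?C / q ^ Suc (2*n)))"
    unfolding h Lcoeff_def c_def by (simp only: mult_ac)
  have "hcoeff \<beta> q a * Lcoeff \<beta> q (a / q) b n =
      qbin \<beta> q n * (hcoeff \<beta> q a * qdesc \<beta> q (a / q) n) * qdesc \<beta> q b n * qmid \<beta> q (?C / q) n"
    unfolding Lcoeff_def by (simp add: mult_ac)
  also have "\<dots> = c * (((1 - \<beta>\<^sup>2 * a / q) * (1 - a / q ^ n) / ((1 - \<beta> * a) * (1 - \<beta> * a / q ^ Suc n)))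
     * ((1 - \<beta> * ?C / q ^ n) / (1 - \<beta>\<^sup>2 * ?C / q ^ Suc n)))"
    unfolding hcoeff_qdesc[OF assms(1,2)] mid(2) c_def by (simp only: mult_ac)
  finally show ?thesis unfolding 1 2 3 id by (simp only: right_diff_distrib distrib_left)
qed

section \<open>The coefficients of E(a): their recurrence and their vanishing for generic
  parameters\<close>

definition defect :: "complex \<Rightarrow> complex \<Rightarrow> complex \<Rightarrow> complex \<Rightarrow> nat \<Rightarrow> complex" where
  "defect \<beta> q a b n = (\<Sum>i\<le>n. Gcoeff \<beta> q a i * Gcoeff \<beta> q b (n - i)) -
     (\<Sum>k\<le>n. Lcoeff \<beta> q a b k * Gcoeff \<beta> q (a * b / q ^ (2 * k)) (n - k))"

lemma Gcoeff_0 [simp]: "Gcoeff \<beta> q A 0 = 1"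
  by (simp add: Gcoeff_def qbin_def qdesc_def)

lemma Lcoeff_0 [simp]: "Lcoeff \<beta> q a b 0 = 1"
  by (simp add: Lcoeff_def qbin_def qdesc_def qmid_def)

lemma defect_rec:
  assumes "q \<noteq> 0" "generic q (\<beta> * a)" "generic q (\<beta> * b)"
     "generic q (\<beta> * (a * b))" "generic q (\<beta>\<^sup>2 * (a * b))" "\<And>n. q ^ Suc n \<noteq> 1"
  shows "defect \<beta> q (q * a) b (Suc n) =
    defect \<beta> q a b (Suc n) + defect \<beta> q a b n - hcoeff \<beta> q a * defect \<beta> q (a / q) b n"
proof -
  let ?G = "Gcoeff \<beta> q" and ?L = "Lcoeff \<beta> q" and ?h = "hcoeff \<beta> q"
  let ?C = "\<lambda>k. a * b / q ^ (2 * k)"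
  have split: "(\<Sum>i\<le>Suc n. f i) = f 0 + (\<Sum>i\<le>n. f (Suc i))" for f :: "nat \<Rightarrow> complex"
    by (rule sum.atMost_Suc_shift)
  have 1: "(\<Sum>i\<le>Suc n. ?G (q * a) i * ?G b (Suc n - i)) =
     (\<Sum>i\<le>Suc n. ?G a i * ?G b (Suc n - i)) + (\<Sum>i\<le>n. ?G a i * ?G b (n - i))
      - ?h a * (\<Sum>i\<le>n. ?G (a / q) i * ?G b (n - i))"
    unfolding split Gcoeff_rec[OF assms(1,2,6)] distrib_right left_diff_distrib sum.distrib sum_subtractf sum_distrib_left
    by (simp add: mult.assoc)
  have "?G (q * ?C k) (Suc (n - k)) = ?G (?C k) (Suc (n - k)) + ?G (?C k) (n - k) - ?h (?C k) * ?G (?C k / q) (n - k)" for k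
    by (rule Gcoeff_rec[OF assms(1) _ assms(6)])
       (use generic_mult(2)[OF assms(4,1), of "2*k"] in simp)
  moreover have "Suc n - k = Suc (n - k)" if "k \<le> n" for k
    using that by simp
  ultimately have G: "?G (q * ?C k) (Suc n - k) = ?G (?C k) (Suc n - k) + ?G (?C k) (n - k) - ?h (?C k) * ?G (?C k / q) (n - k)"
    if "k \<le> n" for k
    using that by simp
  \<comment> \<open>The second equation, q C_(k+1) = C_k / q, is the reason for the compensation:
    the part of the recurrence for L at index k + 1 multiplies the same G as the term with h(C_k) at
    index k.\<close>
  have C1: "q * a * b / q ^ (2 * k) = q * ?C k" "q * ?C (Suc k) = ?C k / q" "a / q * b / q ^ (2 * k) = ?C k / q" for k
    using assms(1) by auto
  have "(\<Sum>k\<le>Suc n. ?L (q * a) b k * ?G (q * a * b / q ^ (2 * k)) (Suc n - k)) =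
    (\<Sum>k\<le>Suc n. ?L a b k * ?G (q * ?C k) (Suc n - k)) +
    (\<Sum>k\<le>n. (?L a b k * ?h (?C k) - ?h a * ?L (a / q) b k) * ?G (?C k / q) (n - k))"
    unfolding C1(1) split Lcoeff_rec[OF assms] C1(2) distrib_right left_diff_distrib sum.distrib sum_subtractf
    by simp
  \<comment> \<open>The term k = n + 1 is set apart: there the index of G is 0, where G is 1 and the
    recurrence, which starts at index 1, does not apply.\<close>
  also have "(\<Sum>k\<le>Suc n. ?L a b k * ?G (q * ?C k) (Suc n - k)) =
    (\<Sum>k\<le>n. ?L a b k * ?G (q * ?C k) (Suc n - k)) + ?L a b (Suc n)" by simp
  also have "(\<Sum>k\<le>n. ?L a b k * ?G (q * ?C k) (Suc n - k)) =
    (\<Sum>k\<le>n. ?L a b k * (?G (?C k) (Suc n - k) + ?G (?C k) (n - k) - ?h (?C k) * ?G (?C k / q) (n - k)))"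
    by (rule sum.cong) (use G in auto)
  also have "\<dots> + ?L a b (Suc n) +
     (\<Sum>k\<le>n. (?L a b k * ?h (?C k) - ?h a * ?L (a / q) b k) * ?G (?C k / q) (n - k)) =
    ((\<Sum>k\<le>n. ?L a b k * ?G (?C k) (Suc n - k)) + ?L a b (Suc n))
    + (\<Sum>k\<le>n. ?L a b k * ?G (?C k) (n - k))
      - ?h a * (\<Sum>k\<le>n. ?L (a / q) b k * ?G (?C k / q) (n - k))"
    unfolding distrib_left distrib_right left_diff_distrib right_diff_distrib sum.distrib sum_subtractf sum_distrib_left
    by (simp add: mult.assoc)
  also have "(\<Sum>k\<le>n. ?L a b k * ?G (?C k) (Suc n - k)) + ?L a b (Suc n) =
    (\<Sum>k\<le>Suc n. ?L a b k * ?G (?C k) (Suc n - k))" by simp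
  finally have 2: "(\<Sum>k\<le>Suc n. ?L (q * a) b k * ?G (q * a * b / q ^ (2 * k)) (Suc n - k)) =
    (\<Sum>k\<le>Suc n. ?L a b k * ?G (?C k) (Suc n - k)) + (\<Sum>k\<le>n. ?L a b k * ?G (?C k) (n - k))
      - ?h a * (\<Sum>k\<le>n. ?L (a / q) b k * ?G (?C k / q) (n - k))" .
  have comb: "(u + v - h * w) - (u' + v' - h * w') = (u - u') + (v - v') - h * (w - w')"
    for u v w u' v' w' h :: complex
    by (simp add: algebra_simps)
  show ?thesis
    unfolding defect_def 1 2 C1(3) by (rule comb)
qed

text \<open>At 0 every denominator equals 1, so continuity at this point holds for all \<beta> and
  c.\<close>

lemma isCont_qdesc_0: "q \<noteq> 0 \<Longrightarrow> isCont (\<lambda>a. qdesc \<beta> q (a * c) n) 0"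
  unfolding qdesc_def by (intro continuous_intros) simp_all

lemma isCont_qmid_0: "q \<noteq> 0 \<Longrightarrow> isCont (\<lambda>a. qmid \<beta> q (a * c) n) 0"
  unfolding qmid_def by (intro continuous_intros) simp_all

lemma isCont_defect:
  assumes "q \<noteq> 0"
  shows "isCont (\<lambda>a. defect \<beta> q a b n) 0"
proof -
  have 1: "isCont (\<lambda>a. qdesc \<beta> q a i) 0" for i
    using isCont_qdesc_0[OF assms, of \<beta> 1] by simp
  have 2: "isCont (\<lambda>a. qdesc \<beta> q (a * b / q ^ (2 * k)) i) 0" for i k
    using isCont_qdesc_0[OF assms, of \<beta> "b / q ^ (2 * k)"] by simp
  show ?thesis
    unfolding defect_def Gcoeff_def Lcoeff_def
    by (intro continuous_diff continuous_sum continuous_mult continuous_const 1 2 isCont_qmid_0 assms)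
qed

lemma qdesc_1: "qdesc \<beta> q 1 n = (if n = 0 then 1 else 0)"
  by (auto simp: qdesc_def intro!: prod_zero)

text \<open>The case \<mu> = 0: the numerator factor 1 - a kills every term of positive index in G_1
  and every l_k with k > 0, so both sides reduce to G_b.\<close>

lemma defect_1: "defect \<beta> q 1 b n = 0"
proof -
  have "(\<Sum>i\<le>n. Gcoeff \<beta> q 1 i * Gcoeff \<beta> q b (n - i)) = (\<Sum>i\<in>{0}. Gcoeff \<beta> q 1 i * Gcoeff \<beta> q b (n - i))"
    by (rule sum.mono_neutral_right) (auto simp: Gcoeff_def qdesc_1)
  moreover have "(\<Sum>k\<le>n. Lcoeff \<beta> q 1 b k * Gcoeff \<beta> q (1 * b / q ^ (2 * k)) (n - k)) =
     (\<Sum>k\<in>{0}. Lcoeff \<beta> q 1 b k * Gcoeff \<beta> q (1 * b / q ^ (2 * k)) (n - k))"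
    by (rule sum.mono_neutral_right) (auto simp: Lcoeff_def qdesc_1)
  ultimately show ?thesis by (simp add: defect_def)
qed

text \<open>The hypotheses on \<open>b\<close> are those on \<open>a\<close> at the point a = 1,
  with which the value at a general point is compared.\<close>

lemma defect_eq_0:
  assumes q: "0 < norm q" "norm q < 1"
    and b: "generic q \<beta>" "generic q (\<beta> * b)" "generic q (\<beta>\<^sup>2 * b)"
    and a: "generic q (\<beta> * a)" "generic q (\<beta> * (a * b))" "generic q (\<beta>\<^sup>2 * (a * b))"
  shows "defect \<beta> q a b n = 0"
  using a
proof (induction n arbitrary: a)
  case 0
  show ?case by (simp add: defect_def)
next
  case (Suc n)
  note IH = Suc.IH
  have q0: "q \<noteq> 0" using q by auto
  have q1: "q ^ Suc n \<noteq> 1" for n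
    by (metis norm_power norm_one power_Suc_less_one q less_irrefl)
  have orbit: "defect \<beta> q (a * q ^ N) b (Suc n) = defect \<beta> q a b (Suc n)"
    if a: "generic q (\<beta> * a)" "generic q (\<beta> * (a * b))" "generic q (\<beta>\<^sup>2 * (a * b))" for N a
  proof (induction N)
    case (Suc N)
    let ?a = "a * q ^ N"
    have up: "generic q (\<beta> * ?a)" "generic q (\<beta> * (?a * b))" "generic q (\<beta>\<^sup>2 * (?a * b))"
      using generic_mult(1)[OF a(1) q0, of N] generic_mult(1)[OF a(2) q0, of N]
        generic_mult(1)[OF a(3) q0, of N] by (simp_all add: mult_ac)
    have down: "generic q (\<beta> * (?a / q))" "generic q (\<beta> * (?a / q * b))" "generic q (\<beta>\<^sup>2 * (?a / q * b))"
      using generic_mult(2)[OF up(1) q0, of 1] generic_mult(2)[OF up(2) q0, of 1]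
        generic_mult(2)[OF up(3) q0, of 1] by simp_all
    have "a * q ^ Suc N = q * ?a" by simp
    \<comment> \<open>The two terms of order n in \<open>defect_rec\<close> vanish by the induction
      hypothesis at \<open>?a\<close> and at \<open>?a / q\<close>; genericity in both directions is
      therefore required.\<close>
    then have "defect \<beta> q (a * q ^ Suc N) b (Suc n) = defect \<beta> q ?a b (Suc n)"
      by (simp only: defect_rec[OF q0 up(1) b(2) up(2,3) q1] IH[OF up] IH[OF down]) simp
    then show ?case using Suc by simp
  qed simp
  have "(\<lambda>N. q ^ N) \<longlonglongrightarrow> 0" by (rule LIMSEQ_power_zero) (use q in simp)
  then have z: "(\<lambda>N. a * q ^ N) \<longlonglongrightarrow> 0" for a by (rule tendsto_mult_right_zero)
  \<comment> \<open>The coefficient is constant along a, a q, a q^2, ..., which tends to 0; by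
    continuity its constant value is the value at 0.\<close>
  have const: "defect \<beta> q a b (Suc n) = defect \<beta> q 0 b (Suc n)"
    if a: "generic q (\<beta> * a)" "generic q (\<beta> * (a * b))" "generic q (\<beta>\<^sup>2 * (a * b))" for a
    using isCont_tendsto_compose[OF isCont_defect[OF q0, of \<beta> b "Suc n"] z[of a]]
    unfolding orbit[OF a] by (simp add: LIMSEQ_const_iff)
  show ?case using const[OF Suc.prems] const[of 1] b defect_1[of \<beta> q b "Suc n"] by simp
qed

subsection \<open>Exceptional values of the parameter\<close>

text \<open>Each pair of exponents m, n excludes one value of x in the linear case and at most two
  in the quadratic case.\<close>

lemma countable_not_generic:
  assumes "c \<noteq> 0" "q \<noteq> 0"
  shows "countable {x. \<not> generic q (x * c)}" "countable {x. \<not> generic q (x\<^sup>2 * c)}"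
proof -
  have "{x. \<not> generic q (x * c)} \<subseteq> (\<Union>m n. {q ^ n / (c * q ^ m)})"
  proof
    fix x assume "x \<in> {x. \<not> generic q (x * c)}"
    then obtain m n where "x * c * q ^ m = q ^ n" by (auto simp: generic_def)
    then have "x = q ^ n / (c * q ^ m)" using assms by (simp add: field_simps)
    then show "x \<in> (\<Union>m n. {q ^ n / (c * q ^ m)})" by blast
  qed
  then show "countable {x. \<not> generic q (x * c)}"
    by (rule countable_subset) auto
  have "{x. \<not> generic q (x\<^sup>2 * c)} \<subseteq> (\<Union>m n. {csqrt (q ^ n / (c * q ^ m)), - csqrt (q ^ n / (c * q ^ m))})"
  proof
    fix x assume "x \<in> {x. \<not> generic q (x\<^sup>2 * c)}"
    then obtain m n where "x\<^sup>2 * c * q ^ m = q ^ n" by (auto simp: generic_def)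
    then have "x\<^sup>2 = q ^ n / (c * q ^ m)" using assms by (simp add: field_simps)
    then have "x\<^sup>2 = (csqrt (q ^ n / (c * q ^ m)))\<^sup>2" by simp
    then show "x \<in> (\<Union>m n. {csqrt (q ^ n / (c * q ^ m)), - csqrt (q ^ n / (c * q ^ m))})"
      unfolding power2_eq_iff by blast
  qed
  then show "countable {x. \<not> generic q (x\<^sup>2 * c)}"
    by (rule countable_subset) auto
qed

lemma LIMSEQ_avoiding_countable:
  fixes x :: complex
  assumes "countable B"
  obtains s where "s \<longlonglongrightarrow> x" "\<And>n::nat. s n \<notin> B"
proof -
  have "\<exists>y. y \<in> ball x (inverse (real (Suc n))) \<and> y \<notin> B" for n
  proof -
    have "uncountable (ball x (inverse (real (Suc n))))" by (rule uncountable_ball) simp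
    then show ?thesis using countable_subset[OF _ assms] by blast
  qed
  then obtain s where s: "\<And>n. s n \<in> ball x (inverse (real (Suc n)))" "\<And>n. s n \<notin> B"
    by metis
  have "s \<longlonglongrightarrow> x"
  proof (rule metric_LIMSEQ_I)
    fix r :: real assume "0 < r"
    then obtain N where N: "inverse (real (Suc N)) < r" using reals_Archimedean by blast
    have "dist (s n) x < r" if "n \<ge> N" for n
    proof -
      have "dist (s n) x < inverse (real (Suc n))" using s(1)[of n] by (simp add: dist_commute)
      also have "\<dots> \<le> inverse (real (Suc N))" using that by (simp add: field_simps)
      finally show ?thesis using N by simp
    qed
    then show "\<exists>no. \<forall>n\<ge>no. dist (s n) x < r" by blast
  qed
  with s(2) show ?thesis using that by blast
qed

text \<open>
  For \<open>\<lambda>\<close> a natural number the series \<open>F\<^sub>\<lambda>\<close> is truncated, and at a special \<open>\<beta>\<close>, such as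
  \<open>\<beta> = q\<close>, the denominators of the omitted terms vanish.  So only the terms in \<open>S\<close> and \<open>T\<close> are
  required to be continuous at \<open>\<beta>\<close>; the others are zero for every parameter \<open>x\<close>.
\<close>

lemma truncated_product_identity:
  assumes q: "0 < norm q" "norm q < 1" and ab: "a \<noteq> 0" "b \<noteq> 0"
    and S: "S \<subseteq> {..n}" "T \<subseteq> {..n}"
    and S0: "\<And>x i. i \<le> n \<Longrightarrow> i \<notin> S \<Longrightarrow> qdesc x q a i * qdesc x q b (n - i) = 0"
    and T0: "\<And>x k. k \<le> n \<Longrightarrow> k \<notin> T \<Longrightarrow>
       qdesc x q a k * qdesc x q b k * qdesc x q (a * b / q ^ (2 * k)) (n - k) = 0"
    and Sa: "\<And>i j. i \<in> S \<Longrightarrow> j < i \<Longrightarrow> \<beta> * a / q ^ Suc j \<noteq> 1"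
    and Sb: "\<And>i j. i \<in> S \<Longrightarrow> j < n - i \<Longrightarrow> \<beta> * b / q ^ Suc j \<noteq> 1"
    and Ta: "\<And>k j. k \<in> T \<Longrightarrow> j < k \<Longrightarrow> \<beta> * a / q ^ Suc j \<noteq> 1"
    and Tb: "\<And>k j. k \<in> T \<Longrightarrow> j < k \<Longrightarrow> \<beta> * b / q ^ Suc j \<noteq> 1"
    and Tab: "\<And>k e. k \<in> T \<Longrightarrow> k \<le> e \<Longrightarrow> e \<le> n + k \<Longrightarrow> \<beta> * (a * b) / q ^ e \<noteq> 1"
  shows "(\<Sum>i\<le>n. Gcoeff \<beta> q a i * Gcoeff \<beta> q b (n - i)) =
     (\<Sum>k\<le>n. Lcoeff \<beta> q a b k * Gcoeff \<beta> q (a * b / q ^ (2 * k)) (n - k))"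
proof -
  have q0: "q \<noteq> 0" using q by auto
  have q1: "1 - q ^ Suc n \<noteq> 0" for n
    by (metis norm_power norm_one power_Suc_less_one q less_irrefl right_minus_eq)
  define L where "L = (\<lambda>x. \<Sum>i\<in>S. Gcoeff x q a i * Gcoeff x q b (n - i))"
  define R where "R = (\<lambda>x. \<Sum>k\<in>T. Lcoeff x q a b k * Gcoeff x q (a * b / q ^ (2 * k)) (n - k))"
  have L_eq: "L x = (\<Sum>i\<le>n. Gcoeff x q a i * Gcoeff x q b (n - i))" for x
    unfolding L_def by (rule sum.mono_neutral_left) (use S S0[of _ x] in \<open>auto simp: Gcoeff_def\<close>)
  have R_eq: "R x = (\<Sum>k\<le>n. Lcoeff x q a b k * Gcoeff x q (a * b / q ^ (2 * k)) (n - k))" for x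
    unfolding R_def by (rule sum.mono_neutral_left) (use S T0[of _ x] in \<open>auto simp: Gcoeff_def Lcoeff_def\<close>)
  have LR: "L x = R x" if "generic q x" "generic q (x * b)" "generic q (x\<^sup>2 * b)"
     "generic q (x * a)" "generic q (x * (a * b))" "generic q (x\<^sup>2 * (a * b))" for x
    using defect_eq_0[OF q that, of n] by (simp add: defect_def L_eq R_eq)
  \<comment> \<open>The six sets are the failures of the hypotheses of \<open>defect_eq_0\<close>,
    read as conditions on the parameter; the factor 1 brings the first into the form of
    \<open>countable_not_generic\<close>.\<close>
  let ?B = "{x. \<not> generic q (x * 1)} \<union> {x. \<not> generic q (x * b)} \<union> {x. \<not> generic q (x\<^sup>2 * b)} \<union>
     {x. \<not> generic q (x * a)} \<union> {x. \<not> generic q (x * (a * b))} \<union> {x. \<not> generic q (x\<^sup>2 * (a * b))}"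
  have "countable ?B"
    using ab q0 by (intro countable_Un countable_not_generic) auto
  from LIMSEQ_avoiding_countable[OF this, of \<beta>] obtain s where
    s: "s \<longlonglongrightarrow> \<beta>" "\<And>n. s n \<notin> ?B" by blast
  have eq: "L (s m) = R (s m)" for m
    by (rule LR) (use s(2)[of m] in auto)
  have cb: "isCont (\<lambda>x. qbin x q i) \<beta>" for i
    unfolding qbin_def by (intro continuous_intros q1)
  have cd: "isCont (\<lambda>x. qdesc x q A i) \<beta>" if "\<And>j. j < i \<Longrightarrow> \<beta> * A / q ^ Suc j \<noteq> 1" for A i
    unfolding qdesc_def by (intro continuous_intros) (use that q0 in auto)
  have cm: "isCont (\<lambda>x. qmid x q (a * b) k) \<beta>" if "\<And>e. k \<le> e \<Longrightarrow> e < 2 * k \<Longrightarrow> \<beta> * (a * b) / q ^ e \<noteq> 1" for k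
    unfolding qmid_def by (intro continuous_intros) (use that q0 in auto)
  have "isCont L \<beta>"
    unfolding L_def Gcoeff_def
    by (intro continuous_sum continuous_mult cb cd) (use Sa Sb in auto)
  have cab: "isCont (\<lambda>x. qdesc x q (a * b / q ^ (2 * k)) (n - k)) \<beta>" if "k \<in> T" for k
  proof (rule cd)
    fix j assume "j < n - k"
    then show "\<beta> * (a * b / q ^ (2 * k)) / q ^ Suc j \<noteq> 1"
      using Tab[OF that, of "2 * k + Suc j"] by (auto simp: power_add mult_ac)
  qed
  have cmT: "isCont (\<lambda>x. qmid x q (a * b) k) \<beta>" if "k \<in> T" for k
    by (rule cm) (rule Tab[OF that], use S that in auto)
  have ca: "isCont (\<lambda>x. qdesc x q a k) \<beta>" "isCont (\<lambda>x. qdesc x q b k) \<beta>" if "k \<in> T" for k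
    by (rule cd, rule Ta[OF that] Tb[OF that], assumption)+
  have "isCont R \<beta>"
    unfolding R_def Gcoeff_def Lcoeff_def
    by (intro continuous_sum continuous_mult cb ca cmT cab) assumption+
  with \<open>isCont L \<beta>\<close>  have "(\<lambda>m. L (s m)) \<longlonglongrightarrow> L \<beta>" "(\<lambda>m. R (s m)) \<longlonglongrightarrow> R \<beta>"
    using isCont_tendsto_compose[OF _ s(1)] by blast+
  then have "L \<beta> = R \<beta>"
    unfolding eq using LIMSEQ_unique by blast
  then show ?thesis by (simp add: L_eq R_eq)
qed

subsection \<open>Shifted factorials\<close>

lemma convergent_prod_qinf:
  fixes x q :: complex
  assumes "norm q < 1"
  shows "convergent_prod (\<lambda>j. 1 - x * q ^ j)"
proof (rule abs_convergent_prod_imp_convergent_prod)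
  have "summable (\<lambda>j. norm x * norm q ^ j)"
    using assms by (intro summable_mult summable_geometric) simp
  then show "abs_convergent_prod (\<lambda>j. 1 - x * q ^ j)"
    unfolding abs_convergent_prod_conv_summable by (simp add: norm_mult norm_power)
qed

lemma LIMSEQ_qinf:
  assumes "norm q < 1"
  shows "(\<lambda>n. \<Prod>j<n. 1 - x * q ^ j) \<longlonglongrightarrow> qinf x q"
proof -
  have "(\<lambda>n. \<Prod>j\<le>n. 1 - x * q ^ j) \<longlonglongrightarrow> qinf x q"
    unfolding qinf_def by (rule convergent_prod_LIMSEQ[OF convergent_prod_qinf[OF assms]])
  then show ?thesis
    unfolding lessThan_Suc_atMost[symmetric] by (rule LIMSEQ_imp_Suc)
qed

lemma qinf_split:
  assumes "norm q < 1"
  shows "qinf x q = (\<Prod>j<k. 1 - x * q ^ j) * qinf (x * q ^ k) q"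
proof -
  have "(\<lambda>n. \<Prod>j<n + k. 1 - x * q ^ j) \<longlonglongrightarrow> qinf x q"
    by (rule LIMSEQ_ignore_initial_segment[OF LIMSEQ_qinf[OF assms]])
  moreover have "(\<Prod>j<n + k. 1 - x * q ^ j) = (\<Prod>j<k. 1 - x * q ^ j) * (\<Prod>j<n. 1 - x * q ^ k * q ^ j)" for n
    by (induction n) (simp_all add: power_add mult_ac)
  moreover have "(\<lambda>n. (\<Prod>j<k. 1 - x * q ^ j) * (\<Prod>j<n. 1 - x * q ^ k * q ^ j)) \<longlonglongrightarrow>
      (\<Prod>j<k. 1 - x * q ^ j) * qinf (x * q ^ k) q"
    by (intro tendsto_mult_left LIMSEQ_qinf assms)
  ultimately show ?thesis using LIMSEQ_unique by simp
qed

lemma qinf_eq_0_iff: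
  assumes "norm q < 1"
  shows "qinf x q = 0 \<longleftrightarrow> (\<exists>j. x * q ^ j = 1)"
proof
  assume "\<exists>j. x * q ^ j = 1"
  then obtain j where "x * q ^ j = 1" by blast
  then show "qinf x q = 0" using qinf_split[OF assms, of x "Suc j"] by simp
next
  assume "qinf x q = 0"
  then show "\<exists>j. x * q ^ j = 1"
    using prodinf_nonzero[OF convergent_prod_qinf[OF assms, of x]] unfolding qinf_def
    by (metis right_minus_eq)
qed

text \<open>The split of k leading factors, listed in reverse order so that they become the
  descending factors that occur in \<open>qdesc\<close>.\<close>

lemma qinf_down:
  assumes "norm q < 1" "q \<noteq> 0"
  shows "qinf (x / q ^ k) q = (\<Prod>j<k. 1 - x / q ^ Suc j) * qinf x q"
proof -
  have "(\<Prod>j<k. 1 - x / q ^ k * q ^ j) = (\<Prod>j<k. 1 - x / q ^ k * q ^ (k - Suc j))"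
    by (rule prod.nat_diff_reindex[symmetric])
  also have "\<dots> = (\<Prod>j<k. 1 - x / q ^ Suc j)"
  proof (rule prod.cong)
    fix j assume "j \<in> {..<k}"
    then have "q ^ k = q ^ Suc j * q ^ (k - Suc j)"
      unfolding power_add[symmetric] by simp
    then show "1 - x / q ^ k * q ^ (k - Suc j) = 1 - x / q ^ Suc j" using assms(2) by simp
  qed simp
  finally show ?thesis using qinf_split[OF assms(1), of "x / q ^ k" k] assms(2) by simp
qed

lemma qinf_self_nonzero:
  assumes "norm q < 1"
  shows "qinf q q \<noteq> 0"
proof
  assume "qinf q q = 0"
  then obtain j where "q ^ Suc j = 1" unfolding qinf_eq_0_iff[OF assms] by auto
  then have "norm q ^ Suc j = 1" by (metis norm_power norm_one)
  then show False using assms by (metis norm_ge_zero power_Suc_less_one power_0_left zero_neq_one less_irrefl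
    order_le_less nat.distinct(1) power_eq_0_iff)
qed

lemma qfac_of_nat [simp]: "qfac x q (of_nat n) = (\<Prod>j<n. 1 - x * q ^ j)"
  by (simp add: qfac_def)

lemma qfac_not_Nats: "l \<notin> \<nat> \<Longrightarrow> qfac x q l = qinf x q / qinf (x * q powr l) q"
  by (simp add: qfac_def)

lemma powr_minus_of_nat:
  fixes q l :: complex
  shows "q \<noteq> 0 \<Longrightarrow> q powr (l - of_nat k) = q powr l / q ^ k"
  by (simp add: powr_diff powr_nat)

lemma diff_of_nat_not_Nats: "l \<notin> \<nat> \<Longrightarrow> l - of_nat k \<notin> (\<nat> :: complex set)"
  by (metis Nats_add diff_add_cancel of_nat_in_Nats)

lemma in_qrange_Nats: "of_nat n - of_nat k \<in> (\<nat> :: complex set) \<longleftrightarrow> k \<le> n"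
proof
  assume "of_nat n - of_nat k \<in> (\<nat> :: complex set)"
  then obtain m where "of_nat n - of_nat k = (of_nat m :: complex)" by (auto elim: Nats_cases)
  then have "of_nat n = (of_nat (m + k) :: complex)" by (simp add: diff_eq_eq)
  then have "n = m + k" by (rule of_nat_eq_iff[THEN iffD1])
  then show "k \<le> n" by simp
next
  assume "k \<le> n"
  then have "of_nat n - of_nat k = (of_nat (n - k) :: complex)" by (simp add: of_nat_diff)
  then show "of_nat n - of_nat k \<in> (\<nat> :: complex set)" by simp
qed

lemma qrange_of_nat: "qrange (of_nat n) = {..n}"
  by (auto simp: qrange_def in_qrange_Nats)

lemma qrange_not_Nats: "l \<notin> \<nat> \<Longrightarrow> qrange l = UNIV"
  by (auto simp: qrange_def)

text \<open>The finite counterpart of \<open>qinf_down\<close>: the top k factors are written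
  downwards from q^n, so that both branches of \<open>qfac\<close> lead to the same ratio.\<close>

lemma prod_lessThan_split_down:
  fixes x q :: complex
  assumes "q \<noteq> 0" "k \<le> n"
  shows "(\<Prod>j<n. 1 - x * q ^ j) = (\<Prod>j<n - k. 1 - x * q ^ j) * (\<Prod>j<k. 1 - x * q ^ n / q ^ Suc j)"
  using assms(2)
proof (induction k)
  case (Suc k)
  then have nk: "n - k = Suc (n - Suc k)" by simp
  have "q ^ n = q ^ (n - Suc k) * q ^ Suc k"
    unfolding power_add[symmetric] using Suc by simp
  then have "x * q ^ n / q ^ Suc k = x * q ^ (n - Suc k)" using assms(1) by simp
  then show ?case using Suc by (simp add: nk)
qed simp

text \<open>Raising the index by k appends the k factors on the right; the hypotheses exclude 0/0.
  If (x;q)_(l-k) has a pole, one of these factors vanishes and the quotient is 0 by the convention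
  for division.\<close>

lemma qfac_ratio:
  assumes q: "q \<noteq> 0" "norm q < 1" and "k \<in> qrange l"
    and "qfac_recip_finite x q (l - of_nat k)" "qfac_finite x q l"
  shows "qfac x q l / qfac x q (l - of_nat k) = (\<Prod>j<k. 1 - x * q powr l / q ^ Suc j)"
proof (cases "l \<in> \<nat>")
  case True
  then obtain n where n: "l = of_nat n" by (auto elim: Nats_cases)
  then have k: "k \<le> n" using assms(3) by (simp add: qrange_of_nat)
  then have eq: "l - of_nat k = of_nat (n - k)" using n by (simp add: of_nat_diff)
  then have nz: "(\<Prod>j<n - k. 1 - x * q ^ j) \<noteq> 0" using assms(4) unfolding eq qfac_recip_finite_def by simp
  have "q powr l = q ^ n" using q(1) by (simp add: n powr_nat)
  then show ?thesis
    unfolding eq using nz unfolding n qfac_of_nat prod_lessThan_split_down[OF q(1) k, of x] by simp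
next
  case False
  have "qinf x q \<noteq> 0" using assms(4) diff_of_nat_not_Nats[OF False, of k] by (simp add: qfac_recip_finite_def)
  moreover have "qinf (x * q powr l) q \<noteq> 0" using assms(5) False by (simp add: qfac_finite_def)
  ultimately show ?thesis
    using qinf_down[OF q(2,1), of "x * q powr l" k]
    by (simp add: qfac_not_Nats[OF False] qfac_not_Nats[OF diff_of_nat_not_Nats[OF False]] powr_minus_of_nat[OF q(1)])
qed

text \<open>Reciprocals are used because (q;q)_l may have a pole; then (q;q)_(l-k) has one as well,
  and both sides are 0.\<close>

lemma qfac_q_recip:
  assumes q: "q \<noteq> 0" "norm q < 1" and "k \<in> qrange l"
  shows "1 / qfac q q (l - of_nat k) = (\<Prod>j<k. 1 - q powr l / q ^ j) * (1 / qfac q q l)"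
proof (cases "l \<in> \<nat>")
  case True
  then obtain n where n: "l = of_nat n" by (auto elim: Nats_cases)
  have nz: "(\<Prod>j<m. 1 - q * q ^ j) \<noteq> 0" for m
    using qinf_split[OF q(2), of q m] qinf_self_nonzero[OF q(2)] by auto
  have "qfac_recip_finite q q (l - of_nat k)"
    using True assms(3) nz by (auto simp: qfac_recip_finite_def qrange_def elim!: Nats_cases)
  from qfac_ratio[OF q assms(3) this] True
  have "qfac q q l / qfac q q (l - of_nat k) = (\<Prod>j<k. 1 - q powr l / q ^ j)"
    using q(1) by (simp add: qfac_finite_def)
  moreover have "qfac q q l \<noteq> 0" using nz[of n] by (simp add: n)
  ultimately show ?thesis by (simp add: field_simps)
next
  case False
  show ?thesis
    using qinf_down[OF q(2,1), of "q * q powr l" k] q(1)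
    by (simp add: qfac_not_Nats[OF False] qfac_not_Nats[OF diff_of_nat_not_Nats[OF False]] powr_minus_of_nat[OF q(1)])
qed

text \<open>For l = n < k the argument is a negative integer, where (q;q) has a pole: the factor of
  index k - n - 1 in the infinite product in the denominator vanishes. Division by zero returns 0
  here, and dividing by this 0 gives the coefficient 0 that truncation requires.\<close>

lemma qfac_q_outside:
  assumes q: "q \<noteq> 0" "norm q < 1" and "k \<notin> qrange l"
  shows "qfac q q (l - of_nat k) = 0"
proof -
  obtain n where n: "l = of_nat n" "n < k" "l - of_nat k \<notin> \<nat>"
    using assms(3) by (auto simp: qrange_def in_qrange_Nats elim!: Nats_cases)
  have "q powr (l - of_nat k) = q ^ n / q ^ k"
    using q(1) by (simp add: n(1) powr_minus_of_nat powr_nat)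
  moreover have "q * (q ^ n / q ^ k) * q ^ (k - Suc n) = 1"
  proof -
    have "q ^ k = q ^ Suc n * q ^ (k - Suc n)" unfolding power_add[symmetric] using n(2) by simp
    then show ?thesis using q(1) by simp
  qed
  ultimately have "qinf (q * q powr (l - of_nat k)) q = 0"
    using qinf_eq_0_iff[OF q(2)] by metis
  then show ?thesis using n(3) by (simp add: qfac_not_Nats)
qed

text \<open>For l = n < k the numerator factor of index n is 1 - q^n / q^n = 0, whatever x
  is.\<close>

lemma qdesc_outside:
  assumes "q \<noteq> 0" "k \<notin> qrange l"
  shows "qdesc x q (q powr l) k = 0"
proof -
  obtain n where n: "l = of_nat n" "n < k"
    using assms(2) by (auto simp: qrange_def in_qrange_Nats elim!: Nats_cases)
  then show ?thesis unfolding qdesc_def using assms(1)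
    by (auto intro!: prod_zero bexI[of _ n] simp: powr_nat)
qed

text \<open>The constant coefficient of F_l, by which the series is normalised.\<close>

definition Xcoeff :: "complex \<Rightarrow> complex \<Rightarrow> complex \<Rightarrow> complex" where
  "Xcoeff \<beta> q l = qfac \<beta> q l / qfac q q l"

lemma qfac_nonzero:
  assumes "qfac_finite x q l" "qfac_recip_finite x q l"
  shows "qfac x q l \<noteq> 0"
  using assms by (auto simp: qfac_finite_def qfac_recip_finite_def qfac_not_Nats split: if_splits)

text \<open>By \<open>qfac_ratio\<close> the product of these factors is a quotient of two nonzero
  numbers.\<close>

lemma qfac_factor_nonzero:
  assumes q: "q \<noteq> 0" "norm q < 1" and k: "k \<in> qrange l"
    and "qfac_finite x q l" "qfac_recip_finite x q l"
    and "qfac_finite x q (l - of_nat k)" "qfac_recip_finite x q (l - of_nat k)"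
    and "j < k"
  shows "x * q powr l / q ^ Suc j \<noteq> 1"
proof -
  have "(\<Prod>j<k. 1 - x * q powr l / q ^ Suc j) \<noteq> 0"
    using qfac_ratio[OF q k assms(7,4)] qfac_nonzero assms(4-7) by (metis divide_eq_0_iff)
  then show ?thesis using \<open>j < k\<close> by auto
qed

lemma Xcoeff_shift:
  assumes q: "q \<noteq> 0" "norm q < 1" and k: "k \<in> qrange l"
    and fin: "qfac_finite \<beta> q l" "qfac_recip_finite \<beta> q l"
      "qfac_finite \<beta> q (l - of_nat k)" "qfac_recip_finite \<beta> q (l - of_nat k)"
  shows "Xcoeff \<beta> q (l - of_nat k) = Xcoeff \<beta> q l * qdesc \<beta> q (q powr l) k"
proof -
  have ratio: "qfac \<beta> q l / qfac \<beta> q (l - of_nat k) = (\<Prod>j<k. 1 - \<beta> * q powr l / q ^ Suc j)"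
    by (rule qfac_ratio[OF q k fin(4,1)])
  have nz: "qfac \<beta> q l \<noteq> 0" "qfac \<beta> q (l - of_nat k) \<noteq> 0"
    using qfac_nonzero fin by blast+
  have "qfac \<beta> q (l - of_nat k) = qfac \<beta> q l * (1 / (\<Prod>j<k. 1 - \<beta> * q powr l / q ^ Suc j))"
    unfolding ratio[symmetric] using nz by simp
  then have "Xcoeff \<beta> q (l - of_nat k) = (qfac \<beta> q l * (1 / (\<Prod>j<k. 1 - \<beta> * q powr l / q ^ Suc j))) *
     (1 / qfac q q (l - of_nat k))"
    by (simp add: Xcoeff_def)
  also have "1 / qfac q q (l - of_nat k) = (\<Prod>j<k. 1 - q powr l / q ^ j) * (1 / qfac q q l)"
    by (rule qfac_q_recip[OF q k])
  finally show ?thesis by (simp add: Xcoeff_def qdesc_def prod_dividef)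
qed

lemma F_coeff_eq:
  "q \<noteq> 0 \<Longrightarrow> F_coeff l \<beta> q k = qbin \<beta> q k * Xcoeff \<beta> q (l - of_nat k)"
  by (simp add: F_coeff_def Xcoeff_def qbin_def prod_dividef)

subsection \<open>The coefficient identity\<close>

locale linearization =
  fixes q \<mu> \<nu> \<beta> :: complex
  assumes q_pos: "0 < norm q" and q_less_1: "norm q < 1" and lin: "lin_defined \<mu> \<nu> \<beta> q"
begin

abbreviation inds :: "nat set" where "inds \<equiv> qrange \<mu> \<inter> qrange \<nu>"

text \<open>The indices of all series F in the contributing part of the identity; finiteness,
  nonvanishing and growth are established once for all of them.\<close>

definition params :: "complex set" where
  "params = {\<mu>, \<nu>} \<union> (\<lambda>k. \<mu> + \<nu> - 2 * of_nat k) ` inds"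

lemma q_nz: "q \<noteq> 0" using q_pos by auto

lemma zero_in_inds: "0 \<in> inds" by (auto simp: qrange_def)

lemma F_defined_params: "l \<in> params \<Longrightarrow> F_defined l \<beta> q"
  using lin unfolding params_def lin_defined_def by blast

lemma linD:
  assumes "k \<in> inds"
  shows "qfac_finite q q (\<mu> + \<nu> - 2 * of_nat k)"
    "qfac_finite (\<beta>\<^sup>2) q (\<mu> + \<nu> - of_nat k)"
    "qfac_recip_finite (\<beta>\<^sup>2) q (\<mu> + \<nu> - 2 * of_nat k)"
    "qfac_recip_finite (q * \<beta>) q (\<mu> + \<nu> - of_nat k)"
  using lin assms unfolding lin_defined_def by blast+

lemma beta_neq_1: "\<beta> \<noteq> 1"
  using lin unfolding lin_defined_def by blast

lemma double_of_nat: "2 * of_nat k = (of_nat (2 * k) :: complex)" by simp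

lemma powr_double: "q powr (\<mu> + \<nu> - 2 * of_nat k) = q powr \<mu> * q powr \<nu> / q ^ (2 * k)"
  unfolding double_of_nat powr_minus_of_nat[OF q_nz] by (simp add: powr_add q_nz)

text \<open>
  If \<open>\<mu> + \<nu>\<close> is a natural number but \<open>\<mu>\<close> or \<open>\<nu>\<close> is not, then some contributing \<open>k\<close> has
  \<open>2 k > \<mu> + \<nu>\<close>, where the numerator \<open>(q;q)\<^sub>\<mu>\<^sub>+\<^sub>\<nu>\<^sub>-\<^sub>2\<^sub>k\<close> has a pole.
\<close>

lemma sum_in_Nats_imp:
  assumes "\<mu> + \<nu> \<in> \<nat>"
  shows "\<mu> \<in> \<nat>" "\<nu> \<in> \<nat>"
proof -
  obtain m where m: "\<mu> + \<nu> = of_nat m" using assms by (auto elim: Nats_cases)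
  have bound: "2 * k \<le> m" if "k \<in> inds" for k
  proof (rule ccontr)
    assume "\<not> 2 * k \<le> m"
    then have "\<mu> + \<nu> - 2 * of_nat k \<notin> \<nat>"
      unfolding m double_of_nat in_qrange_Nats .
    moreover have "q powr (\<mu> + \<nu> - 2 * of_nat k) = q ^ m / q ^ (2 * k)"
      unfolding m double_of_nat powr_minus_of_nat[OF q_nz] by (simp add: powr_nat q_nz)
    moreover have "q * (q ^ m / q ^ (2 * k)) * q ^ (2 * k - Suc m) = 1"
    proof -
      have "q ^ (2 * k) = q ^ Suc m * q ^ (2 * k - Suc m)"
        unfolding power_add[symmetric] using \<open>\<not> 2 * k \<le> m\<close> by simp
      then show ?thesis using q_nz by simp
    qed
    ultimately show False
      using linD(1)[OF that] qinf_eq_0_iff[OF q_less_1] unfolding qfac_finite_def by metis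
  qed
  have "\<mu> \<in> \<nat> \<and> \<nu> \<in> \<nat>"
  proof (rule ccontr)
    assume neg: "\<not> (\<mu> \<in> \<nat> \<and> \<nu> \<in> \<nat>)"
    consider "\<mu> \<notin> \<nat>" "\<nu> \<notin> \<nat>" | n where "\<mu> = of_nat n" "\<nu> \<notin> \<nat>" | n where "\<mu> \<notin> \<nat>" "\<nu> = of_nat n"
      using neg by (metis Nats_cases)
    then show False
    proof cases
      case 1
      then have "Suc m \<in> inds" by (simp add: qrange_not_Nats)
      from bound[OF this] show False by simp
    next
      case (2 n)
      then have "n \<in> inds" by (simp add: qrange_not_Nats qrange_of_nat)
      moreover have "\<not> n \<le> m"
        using 2 m in_qrange_Nats[of m n] by (metis add_diff_cancel_left')
      ultimately show False using bound[of n] by simp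
    next
      case (3 n)
      then have "n \<in> inds" by (simp add: qrange_not_Nats qrange_of_nat)
      moreover have "\<not> n \<le> m"
        using 3 m in_qrange_Nats[of m n] by (metis add_diff_cancel_right')
      ultimately show False using bound[of n] by simp
    qed
  qed
  then show "\<mu> \<in> \<nat>" "\<nu> \<in> \<nat>" by auto
qed

lemma qinf_beta: "qinf \<beta> q = (1 - \<beta>) * qinf (q * \<beta>) q"
  using qinf_split[OF q_less_1, of \<beta> 1] by (simp add: mult.commute)

text \<open>Definedness speaks of (q\<beta>;q) only; with \<beta> \<noteq> 1 it passes to
  (\<beta>;q), whose infinite product is 1 - \<beta> times that of q\<beta>.\<close>

lemma recip_beta_not_Nats:
  assumes "\<mu> + \<nu> \<notin> \<nat>"
  shows "qfac_recip_finite \<beta> q l"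
proof -
  have "qinf (q * \<beta>) q \<noteq> 0"
    using linD(4)[OF zero_in_inds] assms by (simp add: qfac_recip_finite_def)
  then have nz: "qinf \<beta> q \<noteq> 0" using qinf_beta beta_neq_1 by simp
  then have "(\<Prod>j<n. 1 - \<beta> * q ^ j) \<noteq> 0" for n
    using qinf_split[OF q_less_1, of \<beta> n] by auto
  then show ?thesis using nz by (auto simp: qfac_recip_finite_def elim!: Nats_cases)
qed

text \<open>Definedness makes the m factors of (q\<beta>;q)_m nonzero, and \<beta> \<noteq> 1 adds
  the factor of index 0; hence the bound m + 1.\<close>

lemma recip_beta_Nats:
  assumes "\<mu> + \<nu> = of_nat m" "i \<le> Suc m"
  shows "qfac_recip_finite \<beta> q (of_nat i)"
proof -
  have "(\<Prod>j<m. 1 - q * \<beta> * q ^ j) \<noteq> 0"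
    using linD(4)[OF zero_in_inds] assms by (simp add: qfac_recip_finite_def)
  then have *: "1 - q * \<beta> * q ^ j \<noteq> 0" if "j < m" for j using that by auto
  have "1 - \<beta> * q ^ j \<noteq> 0" if "j < i" for j
  proof (cases j)
    case 0
    then show ?thesis using beta_neq_1 by simp
  next
    case (Suc j')
    then show ?thesis using *[of j'] that assms(2) by (simp add: mult_ac)
  qed
  then show ?thesis by (simp add: qfac_recip_finite_def)
qed

text \<open>Here \<mu> and \<nu> are natural numbers by \<open>sum_in_Nats_imp\<close>, and a
  contributing k is at most each of them, so 2k \<le> m.\<close>

lemma params_Nats:
  assumes "l \<in> params" "\<mu> + \<nu> = of_nat m"
  obtains n where "l = of_nat n" "n \<le> m"
proof -
  obtain a b where ab: "\<mu> = of_nat a" "\<nu> = of_nat b"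
    using sum_in_Nats_imp assms(2) by (metis Nats_cases of_nat_in_Nats)
  then have m: "m = a + b" using assms(2) by (metis of_nat_add of_nat_eq_iff)
  from assms(1) consider "l = \<mu>" | "l = \<nu>" | k where "k \<in> inds" "l = \<mu> + \<nu> - 2 * of_nat k"
    unfolding params_def by blast
  then show ?thesis
  proof cases
    case (3 k)
    then have "2 * k \<le> m" using ab m by (simp add: qrange_of_nat)
    then have "l = of_nat (m - 2 * k)" using 3 assms(2) by (simp add: of_nat_diff)
    then show ?thesis using that by simp
  qed (use ab m that in auto)
qed

lemma beta_finite:
  assumes "l \<in> params" "j \<in> qrange l"
  shows "qfac_finite \<beta> q (l - of_nat j)" "qfac_recip_finite \<beta> q (l - of_nat j)"
proof -
  show "qfac_finite \<beta> q (l - of_nat j)"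
    using F_defined_params[OF assms(1)] assms(2) by (simp add: F_defined_def)
  show "qfac_recip_finite \<beta> q (l - of_nat j)"
  proof (cases "\<mu> + \<nu> \<in> \<nat>")
    case True
    then obtain m where m: "\<mu> + \<nu> = of_nat m" by (auto elim: Nats_cases)
    obtain n where n: "l = of_nat n" "n \<le> m" using params_Nats[OF assms(1) m] .
    then have "l - of_nat j = of_nat (n - j)" using assms(2) by (simp add: qrange_of_nat of_nat_diff)
    then show ?thesis using recip_beta_Nats[OF m, of "n - j"] n(2) by simp
  qed (rule recip_beta_not_Nats)
qed

lemma zero_in_qrange: "0 \<in> qrange l" by (simp add: qrange_def)

lemma beta_finite_0:
  assumes "l \<in> params"
  shows "qfac_finite \<beta> q l" "qfac_recip_finite \<beta> q l"
  using beta_finite[OF assms zero_in_qrange] by simp_all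

lemma Xcoeff_params:
  assumes "l \<in> params" "j \<in> qrange l"
  shows "Xcoeff \<beta> q (l - of_nat j) = Xcoeff \<beta> q l * qdesc \<beta> q (q powr l) j"
  by (rule Xcoeff_shift[OF q_nz q_less_1 assms(2) beta_finite_0[OF assms(1)] beta_finite[OF assms]])

text \<open>Within \<open>qrange l\<close> this is \<open>Xcoeff_params\<close>. Outside it both
  sides are 0: the left by division by a vanishing \<open>qfac\<close>, the right by a vanishing
  numerator factor.\<close>

lemma F_coeff_params:
  assumes "l \<in> params"
  shows "F_coeff l \<beta> q j = Xcoeff \<beta> q l * Gcoeff \<beta> q (q powr l) j"
proof (cases "j \<in> qrange l")
  case True
  then show ?thesis
    by (simp add: F_coeff_eq[OF q_nz] Xcoeff_params[OF assms] Gcoeff_def)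
next
  case False
  then show ?thesis
    by (simp add: F_coeff_def Gcoeff_def qdesc_outside[OF q_nz] qfac_q_outside[OF q_nz q_less_1])
qed

lemma factor_params:
  assumes "l \<in> params" "i \<in> qrange l" "j < i"
  shows "\<beta> * q powr l / q ^ Suc j \<noteq> 1"
  by (rule qfac_factor_nonzero[OF q_nz q_less_1 assms(2) beta_finite_0[OF assms(1)] beta_finite[OF assms(1,2)] assms(3)])

lemma qfac_q_nonzero:
  assumes "qfac_finite q q l"
  shows "qfac q q l \<noteq> 0"
proof (rule qfac_nonzero[OF assms])
  have "(\<Prod>j<m. 1 - q * q ^ j) \<noteq> 0" for m
    using qinf_split[OF q_less_1, of q m] qinf_self_nonzero[OF q_less_1] by auto
  then show "qfac_recip_finite q q l"
    using qinf_self_nonzero[OF q_less_1] by (auto simp: qfac_recip_finite_def elim!: Nats_cases)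
qed

text \<open>Two groupings of (\<beta>;q)_(l+1). It absorbs the last factor of
  \<open>lin_coeff\<close> and supplies the (q\<beta>;q) that \<open>qmid\<close> contains.\<close>

lemma qfac_q_beta:
  assumes "qfac_finite \<beta> q l"
  shows "qfac \<beta> q l * ((1 - \<beta> * q powr l) / (1 - \<beta>)) = qfac (q * \<beta>) q l"
proof (cases "l \<in> \<nat>")
  case True
  then obtain n where n: "l = of_nat n" by (auto elim: Nats_cases)
  have "qfac \<beta> q l * (1 - \<beta> * q powr l) = (\<Prod>j<Suc n. 1 - \<beta> * q ^ j)"
    by (simp add: n powr_nat q_nz)
  also have "\<dots> = (1 - \<beta>) * qfac (q * \<beta>) q l"
    by (subst prod.lessThan_Suc_shift) (simp add: n mult_ac)
  finally show ?thesis using beta_neq_1 by (simp add: field_simps)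
next
  case False
  have "qinf (\<beta> * q powr l) q = (1 - \<beta> * q powr l) * qinf (q * \<beta> * q powr l) q"
    using qinf_split[OF q_less_1, of "\<beta> * q powr l" 1] by (simp add: mult_ac)
  moreover have "qinf (\<beta> * q powr l) q \<noteq> 0" using assms False by (simp add: qfac_finite_def)
  ultimately show ?thesis
    using beta_neq_1 by (simp add: qfac_not_Nats[OF False] qinf_beta)
qed

lemma inds_params: "k \<in> inds \<Longrightarrow> \<mu> + \<nu> - 2 * of_nat k \<in> params"
  by (auto simp: params_def)

text \<open>Multiplication by the constant coefficient of F_(\<mu>+\<nu>-2k) cancels
  (q;q)_(\<mu>+\<nu>-2k). The factors with \<beta>^2 and q\<beta> combine to \<open>qmid\<close>,
  the others to \<open>qbin\<close> and to \<open>Xcoeff\<close> at \<mu> - k and \<nu> - k.\<close>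

lemma lin_coeff_inds:
  assumes "k \<in> inds"
  shows "lin_coeff \<mu> \<nu> \<beta> q k * Xcoeff \<beta> q (\<mu> + \<nu> - 2 * of_nat k) =
    Xcoeff \<beta> q \<mu> * Xcoeff \<beta> q \<nu> * Lcoeff \<beta> q (q powr \<mu>) (q powr \<nu>) k"
proof -
  let ?l = "\<mu> + \<nu> - of_nat k" and ?N = "\<mu> + \<nu> - 2 * of_nat k"
  let ?C = "q powr \<mu> * q powr \<nu>"
  have N: "?N = ?l - of_nat k" by simp
  have pl: "q powr ?l = ?C / q ^ k" by (simp add: powr_minus_of_nat powr_add q_nz)
  have kl: "k \<in> qrange ?l"
  proof (cases "\<mu> + \<nu> \<in> \<nat>")
    case True
    then obtain a b where ab: "\<mu> = of_nat a" "\<nu> = of_nat b"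
      using sum_in_Nats_imp by (metis Nats_cases)
    then have k: "k \<le> a" "k \<le> b" using assms by (auto simp: qrange_of_nat)
    then have "?l = of_nat (a + b - k)" by (simp add: ab of_nat_diff)
    then show ?thesis using k by (simp only: qrange_of_nat) auto
  next
    case False
    then show ?thesis using diff_of_nat_not_Nats by (simp add: qrange_not_Nats)
  qed
  have finN: "qfac_finite \<beta> q ?N" using beta_finite_0[OF inds_params[OF assms]] by simp
  \<comment> \<open>Finiteness of (\<beta>;q)_N is inherited: the denominator of (q\<beta>;q) at
    \<open>?l\<close> is the tail, after k + 1 factors, of the denominator of (\<beta>;q)_N.\<close>
  have fin: "qfac_finite (q * \<beta>) q ?l"
  proof (cases "?l \<in> \<nat>")
    case False
    then have "?N \<notin> \<nat>" unfolding N by (rule diff_of_nat_not_Nats)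
    then have "qinf (\<beta> * q powr ?N) q \<noteq> 0" using finN by (simp add: qfac_finite_def)
    then have "qinf (\<beta> * q powr ?N * q ^ Suc k) q \<noteq> 0"
      using qinf_split[OF q_less_1, of "\<beta> * q powr ?N" "Suc k"] by auto
    moreover have "\<beta> * q powr ?N * q ^ Suc k = q * \<beta> * q powr ?l"
      unfolding N powr_minus_of_nat[OF q_nz, of ?l] using q_nz by simp
    ultimately show ?thesis by (simp only: qfac_finite_def) simp
  qed (simp add: qfac_finite_def)
  have recip: "qfac_recip_finite (q * \<beta>) q (?l - of_nat k)"
  proof (cases "?l \<in> \<nat>")
    case True
    then obtain a where a: "?l = of_nat a" by (auto elim: Nats_cases)
    then have k: "k \<le> a" using kl by (simp add: qrange_of_nat)
    then have "?l - of_nat k = of_nat (a - k)" unfolding a by (simp add: of_nat_diff)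
    moreover have "(\<Prod>j<a. 1 - q * \<beta> * q ^ j) \<noteq> 0"
      using linD(4)[OF assms] unfolding a by (simp add: qfac_recip_finite_def)
    then have "(\<Prod>j<a - k. 1 - q * \<beta> * q ^ j) \<noteq> 0" by auto
    ultimately show ?thesis by (simp add: qfac_recip_finite_def)
  next
    case False
    then show ?thesis using linD(4)[OF assms] diff_of_nat_not_Nats[OF False, of k]
      by (simp add: qfac_recip_finite_def)
  qed
  have r1: "qfac (\<beta>\<^sup>2) q ?l / qfac (\<beta>\<^sup>2) q ?N = (\<Prod>j<k. 1 - \<beta>\<^sup>2 * q powr ?l / q ^ Suc j)"
    unfolding N by (rule qfac_ratio[OF q_nz q_less_1 kl]) (use linD[OF assms] in simp_all)
  have r2: "qfac (q * \<beta>) q ?l / qfac (q * \<beta>) q ?N = (\<Prod>j<k. 1 - q * \<beta> * q powr ?l / q ^ Suc j)"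
    unfolding N by (rule qfac_ratio[OF q_nz q_less_1 kl recip fin])
  have "qmid \<beta> q ?C k = (\<Prod>e=0+k..<k+k. (1 - \<beta>\<^sup>2 * ?C / q ^ Suc e) / (1 - \<beta> * ?C / q ^ e))"
    by (simp add: qmid_def mult_2)
  also have "\<dots> = (\<Prod>j<k. (1 - \<beta>\<^sup>2 * ?C / q ^ Suc (j + k)) / (1 - \<beta> * ?C / q ^ (j + k)))"
    unfolding prod.shift_bounds_nat_ivl by (simp add: atLeast0LessThan)
  also have "\<dots> = (\<Prod>j<k. (1 - \<beta>\<^sup>2 * q powr ?l / q ^ Suc j) / (1 - q * \<beta> * q powr ?l / q ^ Suc j))"
    unfolding pl using q_nz by (simp add: power_add mult_ac)
  finally have mid: "qmid \<beta> q ?C k = qfac (\<beta>\<^sup>2) q ?l / qfac (\<beta>\<^sup>2) q ?N / (qfac (q * \<beta>) q ?l / qfac (q * \<beta>) q ?N)"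
    unfolding r1 r2 prod_dividef .
  \<comment> \<open>Here x is (q;q)_N, which cancels between \<open>lin_coeff\<close> and
    \<open>Xcoeff\<close>; the remaining rearrangement is valid for quotients by 0 as well.\<close>
  have cancel: "(x * u1 * u2 * u3 * v) / (v' * w1 * w2 * w3 * y) * z * (t / x) =
      (u1 / w1) * (u2 / w2) * (u3 / w3) * (v / v' / (y / (t * z)))" if "x \<noteq> 0"
    for x u1 u2 u3 v v' w1 w2 w3 y z t :: complex
    using that by (simp add: mult_ac)
  have bin: "qfac \<beta> q (of_nat k) / qfac q q (of_nat k) = qbin \<beta> q k"
    by (simp add: qbin_def prod_dividef)
  have "lin_coeff \<mu> \<nu> \<beta> q k * Xcoeff \<beta> q ?N = Xcoeff \<beta> q (\<mu> - of_nat k) * Xcoeff \<beta> q (\<nu> - of_nat k) *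
     qbin \<beta> q k * qmid \<beta> q ?C k"
    unfolding mid qfac_q_beta[OF finN, symmetric] bin[symmetric] lin_coeff_def Xcoeff_def
    by (rule cancel[OF qfac_q_nonzero[OF linD(1)[OF assms]]])
  then show ?thesis
    using assms Xcoeff_params[of \<mu> k] Xcoeff_params[of \<nu> k]
    by (simp add: Lcoeff_def params_def mult_ac)
qed

lemma lin_coeff_outside: "k \<notin> inds \<Longrightarrow> lin_coeff \<mu> \<nu> \<beta> q k = 0"
  unfolding lin_coeff_def using qfac_q_outside[OF q_nz q_less_1] by auto

lemma Lcoeff_outside: "k \<notin> inds \<Longrightarrow> Lcoeff \<beta> q (q powr \<mu>) (q powr \<nu>) k = 0"
  unfolding Lcoeff_def using qdesc_outside[OF q_nz] by auto

lemma lin_F_coeff: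
  "lin_coeff \<mu> \<nu> \<beta> q k * F_coeff (\<mu> + \<nu> - 2 * of_nat k) \<beta> q j =
    Xcoeff \<beta> q \<mu> * Xcoeff \<beta> q \<nu> * (Lcoeff \<beta> q (q powr \<mu>) (q powr \<nu>) k *
      Gcoeff \<beta> q (q powr \<mu> * q powr \<nu> / q ^ (2 * k)) j)"
proof (cases "k \<in> inds")
  case True
  then show ?thesis
    using lin_coeff_inds[OF True] F_coeff_params[OF inds_params[OF True], of j]
    by (simp add: powr_double mult.assoc)
next
  case False
  then show ?thesis by (simp add: lin_coeff_outside Lcoeff_outside)
qed

lemma coeff_identity:
  "(\<Sum>i\<le>n. F_coeff \<mu> \<beta> q i * F_coeff \<nu> \<beta> q (n - i)) =
   (\<Sum>k\<le>n. lin_coeff \<mu> \<nu> \<beta> q k * F_coeff (\<mu> + \<nu> - 2 * of_nat k) \<beta> q (n - k))"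
proof -
  let ?a = "q powr \<mu>" and ?b = "q powr \<nu>"
  let ?S = "{i. i \<le> n \<and> i \<in> qrange \<mu> \<and> n - i \<in> qrange \<nu>}"
  \<comment> \<open>\<open>?S\<close> and \<open>?T\<close> collect the indices that survive the
    truncation of every series involved.\<close>
  let ?T = "{k. k \<le> n \<and> k \<in> inds \<and> n - k \<in> qrange (\<mu> + \<nu> - 2 * of_nat k)}"
  have "(\<Sum>i\<le>n. Gcoeff \<beta> q ?a i * Gcoeff \<beta> q ?b (n - i)) =
     (\<Sum>k\<le>n. Lcoeff \<beta> q ?a ?b k * Gcoeff \<beta> q (?a * ?b / q ^ (2 * k)) (n - k))"
  proof (rule truncated_product_identity[OF q_pos q_less_1, where S = ?S and T = ?T])
    show "?a \<noteq> 0" "?b \<noteq> 0" using q_nz by auto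
    show "qdesc x q ?a i * qdesc x q ?b (n - i) = 0" if "i \<le> n" "i \<notin> ?S" for x i
      using that qdesc_outside[OF q_nz] by auto
    show "qdesc x q ?a k * qdesc x q ?b k * qdesc x q (?a * ?b / q ^ (2 * k)) (n - k) = 0"
      if "k \<le> n" "k \<notin> ?T" for x k
      using that qdesc_outside[OF q_nz] unfolding powr_double[symmetric] by auto
    show "\<beta> * ?a / q ^ Suc j \<noteq> 1" if "i \<in> ?S" "j < i" for i j
      using factor_params[of \<mu> i j] that by (simp add: params_def)
    show "\<beta> * ?b / q ^ Suc j \<noteq> 1" if "i \<in> ?S" "j < n - i" for i j
      using factor_params[of \<nu> "n - i" j] that by (simp add: params_def)
    show "\<beta> * ?a / q ^ Suc j \<noteq> 1" if "i \<in> ?T" "j < i" for i j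
      using factor_params[of \<mu> i j] that by (simp add: params_def)
    show "\<beta> * ?b / q ^ Suc j \<noteq> 1" if "i \<in> ?T" "j < i" for i j
      using factor_params[of \<nu> i j] that by (simp add: params_def)
    \<comment> \<open>The exponents from k to 2k - 1 come from \<open>qmid\<close>, those from 2k +
      1 to n + k from \<open>qdesc\<close> at C_k.\<close>
    show "\<beta> * (?a * ?b) / q ^ e \<noteq> 1" if "k \<in> ?T" "k \<le> e" "e \<le> n + k" for k e
    proof -
      let ?N = "\<mu> + \<nu> - 2 * of_nat k"
      from that have k: "k \<in> inds" and r: "n - k \<in> qrange ?N" and "k \<le> n" by auto
      show ?thesis
      proof (cases "\<mu> + \<nu> \<in> \<nat>")
        case True
        then obtain m where m: "\<mu> + \<nu> = of_nat m" by (auto elim: Nats_cases)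
        obtain p where p: "?N = of_nat p" "p \<le> m" using params_Nats[OF inds_params[OF k] m] .
        then have "of_nat m = (of_nat (p + 2 * k) :: complex)" using m by (simp add: algebra_simps)
        then have "m = p + 2 * k" by (rule of_nat_eq_iff[THEN iffD1])
        moreover have "n - k \<le> p" using r unfolding p by (simp add: qrange_of_nat)
        \<comment> \<open>Truncation gives e \<le> n + k \<le> p + 2k = m, so the factor in question
          is one of the m + 1 factors of (\<beta>;q)_(m+1), which are nonzero.\<close>
        ultimately have "e \<le> m" using that \<open>k \<le> n\<close> by simp
        have "?a * ?b = q ^ m" using m powr_add[of q \<mu> \<nu>] q_nz by (simp add: powr_nat)
        moreover have "q ^ m = q ^ (m - e) * q ^ e" unfolding power_add[symmetric] using \<open>e \<le> m\<close> by simp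
        ultimately have "\<beta> * (?a * ?b) / q ^ e = \<beta> * q ^ (m - e)" using q_nz by simp
        moreover have "(\<Prod>j<Suc m. 1 - \<beta> * q ^ j) \<noteq> 0"
          using recip_beta_Nats[OF m, of "Suc m"] unfolding qfac_recip_finite_def
          by (simp only: of_nat_in_Nats if_True qfac_of_nat order_refl not_False_eq_True)
        then have "1 - \<beta> * q ^ (m - e) \<noteq> 0" by (subst (asm) prod_zero_iff) auto
        ultimately show ?thesis by simp
      next
        case False
        then have "?N - of_nat e \<notin> \<nat>" "?N \<notin> \<nat>"
          using diff_of_nat_not_Nats[of ?N e] diff_of_nat_not_Nats[of "\<mu> + \<nu>" "2 * k"] by simp_all
        \<comment> \<open>No truncation occurs, so (\<beta>;q) is finite at
          \<open>?N - of_nat e\<close>; the factor of index 2k of this infinite product is the one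
          in question.\<close>
        then have "qinf (\<beta> * q powr (?N - of_nat e)) q \<noteq> 0"
          using beta_finite(1)[OF inds_params[OF k], of e] by (simp add: qrange_not_Nats qfac_finite_def)
        then have "\<beta> * q powr (?N - of_nat e) * q ^ (2 * k) \<noteq> 1"
          using qinf_eq_0_iff[OF q_less_1] by blast
        then show ?thesis
          unfolding powr_minus_of_nat[OF q_nz, of ?N] powr_double using q_nz by (simp add: mult_ac)
      qed
    qed
  qed auto
  then have "Xcoeff \<beta> q \<mu> * Xcoeff \<beta> q \<nu> * (\<Sum>i\<le>n. Gcoeff \<beta> q ?a i * Gcoeff \<beta> q ?b (n - i)) =
     Xcoeff \<beta> q \<mu> * Xcoeff \<beta> q \<nu> * (\<Sum>k\<le>n. Lcoeff \<beta> q ?a ?b k * Gcoeff \<beta> q (?a * ?b / q ^ (2 * k)) (n - k))"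
    by simp
  moreover have "\<mu> \<in> params" "\<nu> \<in> params" by (auto simp: params_def)
  ultimately show ?thesis
    unfolding lin_F_coeff by (simp add: F_coeff_params sum_distrib_left mult_ac)
qed

end

subsection \<open>Convergence\<close>

text \<open>The bound makes T absolutely summable over all pairs, so its sums by rows and by
  antidiagonals agree.\<close>

lemma double_sums:
  fixes T :: "nat \<Rightarrow> nat \<Rightarrow> complex"
  assumes bound: "\<And>k m. norm (T k m) \<le> D k * \<rho> ^ m" and D: "summable D" and \<rho>: "0 \<le> \<rho>" "\<rho> < 1"
    and S: "(\<lambda>n. \<Sum>k\<le>n. T k (n - k)) sums S"
  shows "(\<lambda>k. \<Sum>m. T k m) sums S"
proof -
  have D0: "0 \<le> D k" for k using order_trans[OF norm_ge_zero bound[of k 0]] by simp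
  have geo: "((\<lambda>m. D k * \<rho> ^ m) has_sum (D k * (1 / (1 - \<rho>)))) UNIV" for k
    using \<rho> D0[of k] geometric_sums[of \<rho>]
    by (intro sums_nonneg_imp_has_sum sums_mult mult_nonneg_nonneg) auto
  have Dsum: "(\<lambda>k. D k * (1 / (1 - \<rho>))) summable_on UNIV"
    by (intro summable_on_cmult_left norm_summable_imp_summable_on) (use D D0 in simp)
  have "(\<lambda>(k, m). D k * \<rho> ^ m) summable_on UNIV \<times> UNIV"
    by (rule summable_on_SigmaI[OF _ Dsum]) (use geo \<rho> D0 in auto)
  then have "(\<lambda>x. norm (case x of (k, m) \<Rightarrow> T k m)) summable_on UNIV \<times> UNIV"
    by (rule Infinite_Sum.abs_summable_on_comparison_test') (use bound in auto)
  then have sum: "(\<lambda>(k, m). T k m) summable_on UNIV \<times> UNIV"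
    by (rule abs_summable_summable)
  then obtain R where R: "((\<lambda>(k, m). T k m) has_sum R) (UNIV \<times> UNIV)"
    by (auto simp: summable_on_def)
  have row: "(T k has_sum (\<Sum>m. T k m)) UNIV" for k
  proof -
    have "summable (\<lambda>m. norm (T k m))"
      by (rule summable_comparison_test'[of "\<lambda>m. D k * \<rho> ^ m"])
         (use bound \<rho> in \<open>auto intro!: summable_mult summable_geometric\<close>)
    then show ?thesis
      using norm_summable_imp_has_sum summable_norm_cancel summable_sums by blast
  qed
  have "((\<lambda>k. \<Sum>m. T k m) has_sum R) UNIV"
    by (rule has_sum_SigmaD[OF R]) (use row in simp)
  then have 1: "(\<lambda>k. \<Sum>m. T k m) sums R" by (rule has_sum_imp_sums)
  have "((\<lambda>(n, k). T k (n - k)) has_sum R) (SIGMA n:UNIV. {..n}) \<longleftrightarrow> ((\<lambda>(k, m). T k m) has_sum R) (UNIV \<times> UNIV)"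
    by (rule has_sum_reindex_bij_witness[where j = "\<lambda>(n, k). (k, n - k)" and i = "\<lambda>(k, m). (k + m, k)"]) auto
  then have "((\<lambda>(n, k). T k (n - k)) has_sum R) (SIGMA n:UNIV. {..n})" using R by simp
  then have "((\<lambda>n. \<Sum>k\<le>n. T k (n - k)) has_sum R) UNIV"
    by (rule has_sum_SigmaD) (auto intro!: has_sum_finite)
  then have "R = S" using has_sum_imp_sums S sums_unique2 by blast
  with 1 show ?thesis by simp
qed

section \<open>Geometric bounds for the normalised coefficients\<close>

lemma qprod_bounded:
  fixes q :: complex
  assumes "norm q < 1"
  obtains K where "K > 0" "\<And>n. norm (\<Prod>j<n. 1 - x * q ^ j) \<le> K"
  using convergent_imp_Bseq[OF convergentI[OF LIMSEQ_qinf[OF assms, of x]]] by (auto simp: Bseq_def)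

lemma inverse_qprod_bounded:
  fixes q :: complex
  assumes "norm q < 1" "qinf x q \<noteq> 0"
  obtains K where "K > 0" "\<And>n. norm (inverse (\<Prod>j<n. 1 - x * q ^ j)) \<le> K"
  using convergent_imp_Bseq[OF convergentI[OF tendsto_inverse[OF LIMSEQ_qinf[OF assms(1), of x] assms(2)]]]
  by (auto simp: Bseq_def)

lemma qbin_bounded:
  fixes q :: complex
  assumes "norm q < 1"
  obtains K where "K > 0" "\<And>n. norm (qbin \<beta> q n) \<le> K"
proof -
  have "(\<lambda>n. qbin \<beta> q n) \<longlonglongrightarrow> qinf \<beta> q / qinf q q"
    unfolding qbin_def prod_dividef power_Suc
    by (intro tendsto_divide LIMSEQ_qinf assms qinf_self_nonzero)
  from convergent_imp_Bseq[OF convergentI[OF this]] show ?thesis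
    using that by (auto simp: Bseq_def)
qed

text \<open>Taking -A/q^j out of numerator and denominator isolates the rate q/\<beta> and leaves
  partial products of convergent infinite products.\<close>

lemma qdesc_scaled:
  assumes "q \<noteq> 0" "\<beta> \<noteq> 0" "A \<noteq> 0"
  shows "qdesc \<beta> q A k = (q / \<beta>) ^ k * (\<Prod>j<k. 1 - 1 / A * q ^ j) * inverse (\<Prod>j<k. 1 - q / (\<beta> * A) * q ^ j)"
proof -
  have "(1 - A / q ^ j) / (1 - \<beta> * A / q ^ Suc j) =
    (q / \<beta>) * ((1 - 1 / A * q ^ j) / (1 - q / (\<beta> * A) * q ^ j))" for j
  proof -
    have "1 - A / q ^ j = - (A / q ^ j) * (1 - 1 / A * q ^ j)"
      using assms by (simp add: field_simps)
    moreover have "1 - \<beta> * A / q ^ Suc j = - (A / q ^ j) * ((\<beta> / q) * (1 - q / (\<beta> * A) * q ^ j))"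
      using assms by (simp add: field_simps)
    moreover have "- (A / q ^ j) \<noteq> 0" using assms by simp
    ultimately show ?thesis using assms(1,2) by (simp only: mult_divide_mult_cancel_left) simp
  qed
  note factor = this
  have assoc: "x * (u / v) = x * u * inverse v" for x u v :: complex
    by (simp add: divide_inverse)
  show ?thesis
    unfolding qdesc_def factor prod.distrib prod_dividef prod_constant card_lessThan power_divide
    by (rule assoc)
qed

lemma qdesc_bounded:
  assumes q: "q \<noteq> 0" "norm q < 1" and nz: "\<beta> \<noteq> 0" "A \<noteq> 0" and "\<And>j. \<beta> * A / q ^ Suc j \<noteq> 1"
  obtains K where "K > 0" "\<And>n. norm (qdesc \<beta> q A n) \<le> K * norm (q / \<beta>) ^ n"
proof -
  have "qinf (q / (\<beta> * A)) q \<noteq> 0"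
    unfolding qinf_eq_0_iff[OF q(2)]
  proof
    assume "\<exists>j. q / (\<beta> * A) * q ^ j = 1"
    then obtain j where "q / (\<beta> * A) * q ^ j = 1" by blast
    then have "\<beta> * A / q ^ Suc j = 1" using q(1) nz by (simp add: field_simps)
    then show False using assms(5) by blast
  qed
  from inverse_qprod_bounded[OF q(2) this] obtain K1 where
    K1: "K1 > 0" "\<And>n. norm (inverse (\<Prod>j<n. 1 - q / (\<beta> * A) * q ^ j)) \<le> K1" by blast
  obtain K2 where K2: "K2 > 0" "\<And>n. norm (\<Prod>j<n. 1 - 1 / A * q ^ j) \<le> K2"
    using qprod_bounded[OF q(2)] by blast
  have "norm (qdesc \<beta> q A n) \<le> (K2 * K1) * norm (q / \<beta>) ^ n" for n
  proof -
    have "norm (qdesc \<beta> q A n) = norm (q / \<beta>) ^ n * (norm (\<Prod>j<n. 1 - 1 / A * q ^ j) *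
        norm (inverse (\<Prod>j<n. 1 - q / (\<beta> * A) * q ^ j)))"
      by (simp only: qdesc_scaled[OF q(1) nz] norm_mult norm_power mult.assoc)
    also have "\<dots> \<le> norm (q / \<beta>) ^ n * (K2 * K1)"
      by (intro mult_left_mono mult_mono K1(2) K2(2)) (use K1(1) K2(1) in auto)
    finally show ?thesis by (simp only: mult.commute)
  qed
  moreover have "K2 * K1 > 0" using K1 K2 by simp
  ultimately show ?thesis using that by blast
qed

text \<open>Uniformity in p comes from qdesc(C, p + n) = qdesc(C, p) qdesc(C/q^p, n): the first
  factor has an inverse bounded by a multiple of |q/\<beta>|^(-p), so the powers of index p
  cancel.\<close>

lemma qdesc_quotient_bounded:
  assumes q: "q \<noteq> 0" "norm q < 1" and nz: "\<beta> \<noteq> 0" "C \<noteq> 0"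
    and "\<And>j. \<beta> * C / q ^ Suc j \<noteq> 1" and C: "\<And>j. C / q ^ j \<noteq> 1"
  obtains K where "K > 0" "\<And>p n. norm (qdesc \<beta> q (C / q ^ p) n) \<le> K * norm (q / \<beta>) ^ n"
proof -
  let ?r = "norm (q / \<beta>)"
  obtain K1 where K1: "K1 > 0" "\<And>n. norm (qdesc \<beta> q C n) \<le> K1 * ?r ^ n"
    using qdesc_bounded[OF q nz assms(5)] by blast
  have "qinf (1 / C) q \<noteq> 0"
    unfolding qinf_eq_0_iff[OF q(2)] using C q(1) nz(2) by (auto simp: field_simps)
  from inverse_qprod_bounded[OF q(2) this] obtain K2 where
    K2: "K2 > 0" "\<And>n. norm (inverse (\<Prod>j<n. 1 - 1 / C * q ^ j)) \<le> K2" by blast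
  obtain K3 where K3: "K3 > 0" "\<And>n. norm (\<Prod>j<n. 1 - q / (\<beta> * C) * q ^ j) \<le> K3"
    using qprod_bounded[OF q(2)] by blast
  have r0: "?r > 0" using q(1) nz(1) by simp
  have inv: "norm (inverse (qdesc \<beta> q C p)) \<le> inverse (?r ^ p) * (K2 * K3)" for p
    unfolding qdesc_scaled[OF q(1) nz] inverse_mult_distrib inverse_inverse_eq norm_mult norm_power
      norm_inverse[of "(q / \<beta>) ^ p"] mult.assoc
    by (intro mult_left_mono mult_mono K2(2) K3(2)) (use K2(1) K3(1) in auto)
  have "norm (qdesc \<beta> q (C / q ^ p) n) \<le> (K1 * (K2 * K3)) * ?r ^ n" for p n
  proof -
    have "qdesc \<beta> q C (p + n) = qdesc \<beta> q C p * qdesc \<beta> q (C / q ^ p) n"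
      unfolding qdesc_def using q(1) by (induction n) (simp_all add: power_add mult_ac)
    moreover have "qdesc \<beta> q C p \<noteq> 0"
      unfolding qdesc_def using assms(5) C by auto
    ultimately have "qdesc \<beta> q (C / q ^ p) n = qdesc \<beta> q C (p + n) * inverse (qdesc \<beta> q C p)" by simp
    then have "norm (qdesc \<beta> q (C / q ^ p) n) = norm (qdesc \<beta> q C (p + n)) * norm (inverse (qdesc \<beta> q C p))"
      by (simp only: norm_mult)
    also have "\<dots> \<le> (K1 * ?r ^ (p + n)) * (inverse (?r ^ p) * (K2 * K3))"
      by (intro mult_mono K1(2) inv) (use K1(1) r0 in auto)
    also have "\<dots> = (K1 * (K2 * K3)) * ?r ^ n" using r0 q(1) nz(1) by (simp add: power_add)
    finally show ?thesis .
  qed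
  moreover have "K1 * (K2 * K3) > 0" using K1 K2 K3 by simp
  ultimately show ?thesis using that by blast
qed

text \<open>Each of the k factors contributes \<beta>/q; the rest are quotients of partial products
  that are bounded together with their inverses.\<close>

lemma qmid_bounded:
  assumes q: "q \<noteq> 0" "norm q < 1" and nz: "\<beta> \<noteq> 0" "C \<noteq> 0"
    and b1: "\<And>j. \<beta> * C / q ^ j \<noteq> 1" and b2: "\<And>j. \<beta>\<^sup>2 * C / q ^ j \<noteq> 1"
  obtains K where "K > 0" "\<And>k. norm (qmid \<beta> q C k) \<le> K * norm (\<beta> / q) ^ k"
proof -
  let ?U = "\<lambda>n. \<Prod>j<n. 1 - q / (\<beta>\<^sup>2 * C) * q ^ j" and ?V = "\<lambda>n. \<Prod>j<n. 1 - 1 / (\<beta> * C) * q ^ j"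
  have U0: "qinf (q / (\<beta>\<^sup>2 * C)) q \<noteq> 0"
    unfolding qinf_eq_0_iff[OF q(2)]
  proof
    assume "\<exists>j. q / (\<beta>\<^sup>2 * C) * q ^ j = 1"
    then obtain j where "q / (\<beta>\<^sup>2 * C) * q ^ j = 1" by blast
    then have "\<beta>\<^sup>2 * C / q ^ Suc j = 1" using q(1) nz by (simp add: field_simps)
    then show False using b2 by blast
  qed
  have V0: "qinf (1 / (\<beta> * C)) q \<noteq> 0"
    unfolding qinf_eq_0_iff[OF q(2)]
  proof
    assume "\<exists>j. 1 / (\<beta> * C) * q ^ j = 1"
    then obtain j where "1 / (\<beta> * C) * q ^ j = 1" by blast
    then have "\<beta> * C / q ^ j = 1" using q(1) nz by (simp add: field_simps)
    then show False using b1 by blast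
  qed
  obtain K1 where K1: "K1 > 0" "\<And>n. norm (?U n) \<le> K1" using qprod_bounded[OF q(2)] by blast
  obtain K2 where K2: "K2 > 0" "\<And>n. norm (inverse (?U n)) \<le> K2" using inverse_qprod_bounded[OF q(2) U0] by blast
  obtain K3 where K3: "K3 > 0" "\<And>n. norm (?V n) \<le> K3" using qprod_bounded[OF q(2)] by blast
  obtain K4 where K4: "K4 > 0" "\<And>n. norm (inverse (?V n)) \<le> K4" using inverse_qprod_bounded[OF q(2) V0] by blast
  have U: "?U n \<noteq> 0" for n using qinf_split[OF q(2), of "q / (\<beta>\<^sup>2 * C)" n] U0 by auto
  have V: "?V n \<noteq> 0" for n using qinf_split[OF q(2), of "1 / (\<beta> * C)" n] V0 by auto
  have ratio: "(1 - \<beta>\<^sup>2 * C / q ^ Suc e) / (1 - \<beta> * C / q ^ e) =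
      (\<beta> / q) * ((1 - q / (\<beta>\<^sup>2 * C) * q ^ e) / (1 - 1 / (\<beta> * C) * q ^ e))" for e
  proof -
    have "1 - \<beta>\<^sup>2 * C / q ^ Suc e = - (\<beta> * C / q ^ e) * ((\<beta> / q) * (1 - q / (\<beta>\<^sup>2 * C) * q ^ e))"
      using q(1) nz by (simp add: field_simps power2_eq_square)
    moreover have "1 - \<beta> * C / q ^ e = - (\<beta> * C / q ^ e) * (1 - 1 / (\<beta> * C) * q ^ e)"
      using q(1) nz by (simp add: field_simps)
    moreover have "- (\<beta> * C / q ^ e) \<noteq> 0" using q(1) nz by simp
    ultimately show ?thesis by (simp only: mult_divide_mult_cancel_left) simp
  qed
  have ivl: "(\<Prod>j=k..<2*k. f j) = (\<Prod>j<2*k. f j) * inverse (\<Prod>j<k. f j)"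
    if "(\<Prod>j<k. f j) \<noteq> 0" for f :: "nat \<Rightarrow> complex" and k
    using that prod.atLeastLessThan_concat[of 0 k "2 * k" f] by (simp add: atLeast0LessThan field_simps)
  have "qmid \<beta> q C k = (\<beta> / q) ^ k * (?U (2*k) * inverse (?U k) * inverse (?V (2*k) * inverse (?V k)))" for k
    unfolding qmid_def ratio prod.distrib prod_dividef ivl[OF U] ivl[OF V]
    by (simp add: divide_inverse power_mult_distrib power_inverse)
  moreover have "norm (?U (2*k) * inverse (?U k) * inverse (?V (2*k) * inverse (?V k))) \<le> K1 * K2 * (K4 * K3)" for k
    unfolding inverse_mult_distrib inverse_inverse_eq norm_mult
    by (intro mult_mono K1 K2 K3 K4) (use K1(1) K2(1) K3(1) K4(1) in auto)
  ultimately have "norm (qmid \<beta> q C k) \<le> norm (\<beta> / q) ^ k * (K1 * K2 * (K4 * K3))" for k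
    by (simp only: norm_mult norm_power) (intro mult_left_mono, auto)
  then show ?thesis using that[of "K1 * K2 * (K4 * K3)"] K1 K2 K3 K4 by (simp add: mult.commute)
qed

text \<open>Serves the truncated series, where the product bounds may fail because omitted
  denominators can vanish.\<close>

lemma finite_support_geometric_bound:
  fixes f :: "nat \<Rightarrow> complex"
  assumes "r > 0" "\<And>n. n > N \<Longrightarrow> f n = 0"
  obtains K where "K > 0" "\<And>n. norm (f n) \<le> K * r ^ n"
proof -
  let ?K = "1 + (\<Sum>n\<le>N. norm (f n) / r ^ n)"
  have "norm (f n) \<le> ?K * r ^ n" for n
  proof (cases "n \<le> N")
    case True
    then have "norm (f n) / r ^ n \<le> (\<Sum>n\<le>N. norm (f n) / r ^ n)"
      by (intro member_le_sum) (use assms(1) in auto)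
    then have "norm (f n) / r ^ n \<le> ?K" by simp
    then show ?thesis using assms(1) by (simp add: pos_divide_le_eq)
  next
    case False
    then show ?thesis using assms by (auto intro!: mult_nonneg_nonneg add_nonneg_nonneg sum_nonneg)
  qed
  moreover have "?K > 0" using assms(1) by (intro add_pos_nonneg sum_nonneg) auto
  ultimately show ?thesis using that by blast
qed

section \<open>The identity of formal power series\<close>

lemma F_fps_nth: "fps_nth (F_fps l \<beta> q) n = (if even n then F_coeff l \<beta> q (n div 2) else 0)"
  by (simp add: F_fps_def)

lemma F_fps_mult_nth:
  "fps_nth (F_fps l \<beta> q * F_fps l' \<beta> q) n =
     (if even n then \<Sum>i\<le>n div 2. F_coeff l \<beta> q i * F_coeff l' \<beta> q (n div 2 - i) else 0)"
proof (cases "even n")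
  case False
  then have "fps_nth (F_fps l \<beta> q) i * fps_nth (F_fps l' \<beta> q) (n - i) = 0" if "i \<le> n" for i
    using that by (auto simp: F_fps_nth)
  then have "(\<Sum>i=0..n. fps_nth (F_fps l \<beta> q) i * fps_nth (F_fps l' \<beta> q) (n - i)) = 0"
    by (intro sum.neutral) simp
  then show ?thesis using False by (simp add: fps_mult_nth)
next
  case True
  then obtain p where p: "n = 2 * p" by blast
  have "(\<Sum>i=0..n. fps_nth (F_fps l \<beta> q) i * fps_nth (F_fps l' \<beta> q) (n - i)) =
      (\<Sum>i\<in>(*) 2 ` {..p}. fps_nth (F_fps l \<beta> q) i * fps_nth (F_fps l' \<beta> q) (n - i))"
  proof (rule sum.mono_neutral_right)
    show "\<forall>i\<in>{0..n} - (*) 2 ` {..p}. fps_nth (F_fps l \<beta> q) i * fps_nth (F_fps l' \<beta> q) (n - i) = 0"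
      by (auto simp: F_fps_nth p elim!: evenE)
  qed (auto simp: p)
  also have "\<dots> = (\<Sum>i\<le>p. F_coeff l \<beta> q i * F_coeff l' \<beta> q (p - i))"
    by (subst sum.reindex) (auto simp: inj_on_def F_fps_nth p simp flip: diff_mult_distrib2)
  finally show ?thesis by (simp add: fps_mult_nth p)
qed

context linearization
begin

text \<open>Term k starts at degree 2k, so every coefficient of the partial sums is eventually
  constant, with the value given by \<open>coeff_identity\<close>.\<close>

lemma sums_fps:
  "(\<lambda>k. fps_const (lin_coeff \<mu> \<nu> \<beta> q k) * fps_X ^ (2 * k) * F_fps (\<mu> + \<nu> - 2 * of_nat k) \<beta> q)
     sums (F_fps \<mu> \<beta> q * F_fps \<nu> \<beta> q)"
  unfolding sums_def
proof (rule tendsto_fpsI)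
  fix n
  let ?t = "\<lambda>k. fps_const (lin_coeff \<mu> \<nu> \<beta> q k) * fps_X ^ (2 * k) * F_fps (\<mu> + \<nu> - 2 * of_nat k) \<beta> q"
  have t: "fps_nth (?t k) n = (if even n \<and> k \<le> n div 2 then
      lin_coeff \<mu> \<nu> \<beta> q k * F_coeff (\<mu> + \<nu> - 2 * of_nat k) \<beta> q (n div 2 - k) else 0)" for k
  proof -
    have "(n - 2 * k) div 2 = n div 2 - k" by simp
    then show ?thesis by (auto simp: mult.assoc fps_X_power_mult_nth F_fps_nth)
  qed
  have "fps_nth (\<Sum>k<N. ?t k) n = fps_nth (F_fps \<mu> \<beta> q * F_fps \<nu> \<beta> q) n" if "N > n" for N
  proof -
    have "fps_nth (\<Sum>k<N. ?t k) n = (\<Sum>k<N. fps_nth (?t k) n)" by (rule fps_sum_nth)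
    also have "\<dots> = (\<Sum>k\<le>n div 2. fps_nth (?t k) n)"
      by (rule sum.mono_neutral_right) (use that t in auto)
    also have "\<dots> = fps_nth (F_fps \<mu> \<beta> q * F_fps \<nu> \<beta> q) n"
      unfolding F_fps_mult_nth coeff_identity by (simp add: t)
    finally show ?thesis .
  qed
  then show "\<forall>\<^sub>F N in sequentially. fps_nth (\<Sum>k<N. ?t k) n = fps_nth (F_fps \<mu> \<beta> q * F_fps \<nu> \<beta> q) n"
    by (rule eventually_sequentiallyI[of "Suc n", rotated]) simp
qed

section \<open>Absolute convergence and the identity of functions\<close>

lemma F_coeff_bounded:
  assumes "\<beta> \<noteq> 0" "l \<in> params"
  obtains K where "K > 0" "\<And>j. norm (F_coeff l \<beta> q j) \<le> K * norm (q / \<beta>) ^ j"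
proof (cases "l \<in> \<nat>")
  case True
  then obtain n where n: "l = of_nat n" by (auto elim: Nats_cases)
  have "norm (q / \<beta>) > 0" using assms q_nz by simp
  moreover have "F_coeff l \<beta> q j = 0" if "j > n" for j
  proof -
    have "j \<notin> qrange l" using that by (simp add: n qrange_of_nat)
    then show ?thesis by (simp add: F_coeff_def qfac_q_outside[OF q_nz q_less_1])
  qed
  ultimately show ?thesis using finite_support_geometric_bound that by blast
next
  case False
  have "\<beta> * q powr l / q ^ Suc j \<noteq> 1" for j
    using factor_params[OF assms(2), of "Suc j" j] False by (simp add: qrange_not_Nats)
  from qdesc_bounded[OF q_nz q_less_1 assms(1) _ this] q_nz obtain K1 where
    K1: "K1 > 0" "\<And>n. norm (qdesc \<beta> q (q powr l) n) \<le> K1 * norm (q / \<beta>) ^ n" by auto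
  obtain K2 where K2: "K2 > 0" "\<And>n. norm (qbin \<beta> q n) \<le> K2"
    using qbin_bounded[OF q_less_1] by blast
  let ?X = "norm (Xcoeff \<beta> q l)"
  \<comment> \<open>The summand 1 keeps the constant positive even if
    \<open>Xcoeff \<beta> q l\<close> is 0.\<close>
  have "norm (F_coeff l \<beta> q j) \<le> ((1 + ?X) * (K2 * K1)) * norm (q / \<beta>) ^ j" for j
  proof -
    have "norm (F_coeff l \<beta> q j) = ?X * (norm (qbin \<beta> q j) * norm (qdesc \<beta> q (q powr l) j))"
      by (simp add: F_coeff_params[OF assms(2)] Gcoeff_def norm_mult)
    also have "\<dots> \<le> (1 + ?X) * (K2 * (K1 * norm (q / \<beta>) ^ j))"
      by (intro mult_mono K1(2) K2(2)) (use K1(1) K2(1) in auto)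
    finally show ?thesis by (simp only: mult.assoc)
  qed
  moreover have "(1 + ?X) * (K2 * K1) > 0" using K1 K2 by (intro mult_pos_pos add_pos_nonneg) auto
  ultimately show ?thesis using that by blast
qed

lemma term_bound:
  assumes "\<beta> \<noteq> 0" "norm c \<le> K * norm (q / \<beta>) ^ j"
  shows "norm (c * z ^ (2 * j)) \<le> K * norm (q * z\<^sup>2 / \<beta>) ^ j"
proof -
  have "norm (c * z ^ (2 * j)) = norm c * norm (z\<^sup>2) ^ j"
    by (simp add: norm_mult norm_power power_mult)
  also have "\<dots> \<le> K * norm (q / \<beta>) ^ j * norm (z\<^sup>2) ^ j"
    by (intro mult_right_mono assms) simp
  also have "\<dots> = K * norm (q * z\<^sup>2 / \<beta>) ^ j"
    by (simp add: norm_mult norm_divide power_mult_distrib power_divide)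
  finally show ?thesis .
qed

lemma F_summable_params:
  assumes "\<beta> \<noteq> 0" "norm (q * z\<^sup>2 / \<beta>) < 1" "l \<in> params"
  shows "F_summable l z \<beta> q"
proof -
  obtain K where K: "\<And>j. norm (F_coeff l \<beta> q j) \<le> K * norm (q / \<beta>) ^ j"
    using F_coeff_bounded[OF assms(1,3)] by blast
  show ?thesis unfolding F_summable_def
    by (rule summable_comparison_test'[of "\<lambda>j. K * norm (q * z\<^sup>2 / \<beta>) ^ j"])
       (use assms K term_bound[OF assms(1)] in \<open>auto intro!: summable_mult summable_geometric\<close>)
qed

text \<open>If \<open>inds\<close> is finite, each row may have its own constant. Otherwise none of
  \<mu>, \<nu> and \<mu> + \<nu> is a natural number, no series is truncated, and the product bounds
  hold uniformly in k.\<close>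

lemma double_bound:
  assumes "\<beta> \<noteq> 0" "norm (q * z\<^sup>2 / \<beta>) < 1"
  obtains D where "summable D"
    "\<And>k m. norm (lin_coeff \<mu> \<nu> \<beta> q k * z ^ (2 * k) * (F_coeff (\<mu> + \<nu> - 2 * of_nat k) \<beta> q m * z ^ (2 * m)))
       \<le> D k * norm (q * z\<^sup>2 / \<beta>) ^ m"
proof (cases "finite inds")
  case True
  have "\<exists>K. k \<in> inds \<longrightarrow> (\<forall>j. norm (F_coeff (\<mu> + \<nu> - 2 * of_nat k) \<beta> q j) \<le> K * norm (q / \<beta>) ^ j)" for k
    using F_coeff_bounded[OF assms(1) inds_params] by metis
  then obtain K where K: "\<And>k j. k \<in> inds \<Longrightarrow> norm (F_coeff (\<mu> + \<nu> - 2 * of_nat k) \<beta> q j) \<le> K k * norm (q / \<beta>) ^ j"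
    by metis
  define D where "D = (\<lambda>k. if k \<in> inds then norm (lin_coeff \<mu> \<nu> \<beta> q k * z ^ (2 * k)) * K k else 0)"
  have "summable D" by (rule summable_finite[OF True]) (auto simp: D_def)
  moreover have "norm (lin_coeff \<mu> \<nu> \<beta> q k * z ^ (2 * k) * (F_coeff (\<mu> + \<nu> - 2 * of_nat k) \<beta> q m * z ^ (2 * m)))
       \<le> D k * norm (q * z\<^sup>2 / \<beta>) ^ m" for k m
  proof (cases "k \<in> inds")
    case True
    show ?thesis
      unfolding norm_mult[of "lin_coeff \<mu> \<nu> \<beta> q k * z ^ (2 * k)"]
      using True term_bound[OF assms(1) K[OF True]] by (simp add: D_def mult.assoc mult_left_mono)
  next
    case False
    then have "D k = 0" unfolding D_def by (rule if_not_P)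
    then show ?thesis by (simp add: lin_coeff_outside[OF False])
  qed
  ultimately show ?thesis using that by blast
next
  case False
  have inf: "\<mu> \<notin> \<nat>" "\<nu> \<notin> \<nat>"
    using False by (auto elim!: Nats_cases simp: qrange_of_nat)
  then have UNIV: "inds = UNIV" by (simp add: qrange_not_Nats)
  have sum: "\<mu> + \<nu> \<notin> \<nat>" using inf sum_in_Nats_imp by blast
  let ?a = "q powr \<mu>" and ?b = "q powr \<nu>" and ?r = "norm (q / \<beta>)"
  let ?C = "?a * ?b"
  have r: "?r > 0" using assms(1) q_nz by simp
  have nz: "?a \<noteq> 0" "?b \<noteq> 0" "?C \<noteq> 0" using q_nz by auto
  have pM: "q powr (\<mu> + \<nu>) = ?C" by (simp add: powr_add q_nz)
  have "0 \<in> inds" using UNIV by simp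
  then have M: "\<mu> + \<nu> \<in> params" using inds_params[of 0] by simp
  have a: "\<beta> * ?a / q ^ Suc j \<noteq> 1" and b: "\<beta> * ?b / q ^ Suc j \<noteq> 1" and C1: "\<beta> * ?C / q ^ Suc j \<noteq> 1" for j
    using factor_params[of \<mu> "Suc j" j] factor_params[of \<nu> "Suc j" j] factor_params[OF M, of "Suc j" j] inf sum
    by (auto simp: params_def qrange_not_Nats pM)
  have "qinf (\<beta> * ?C) q \<noteq> 0"
    using beta_finite_0(1)[OF M] sum by (simp add: qfac_finite_def pM)
  then have C1': "\<beta> * ?C \<noteq> 1" using qinf_eq_0_iff[OF q_less_1] by (metis mult.right_neutral power_0)
  have C1: "\<beta> * ?C / q ^ j \<noteq> 1" for j using C1[of "j - 1"] C1' by (cases j) auto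
  have C2: "\<beta>\<^sup>2 * ?C / q ^ j \<noteq> 1" for j
  proof -
    have "qinf (\<beta>\<^sup>2 * (?C / q ^ j)) q \<noteq> 0"
      using linD(2)[of j] UNIV diff_of_nat_not_Nats[OF sum, of j]
      unfolding qfac_finite_def powr_minus_of_nat[OF q_nz] pM by simp
    then show ?thesis using qinf_eq_0_iff[OF q_less_1] by (metis mult.right_neutral power_0 times_divide_eq_right)
  qed
  \<comment> \<open>That (q;q)_(\<mu>+\<nu>-2k) has no pole for k = j + 1 gives this: the factor of
    index j + 1 of its denominator is 1 - C/q^j.\<close>
  have C0: "?C / q ^ j \<noteq> 1" for j
  proof -
    have "\<mu> + \<nu> - 2 * of_nat (Suc j) \<notin> \<nat>" using diff_of_nat_not_Nats[OF sum, of "2 * Suc j"] by simp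
    then have "qinf (q * (?C / q ^ (2 * Suc j))) q \<noteq> 0"
      using linD(1)[of "Suc j"] UNIV unfolding qfac_finite_def powr_double by blast
    then have "q * (?C / q ^ (2 * Suc j)) * q ^ (Suc j) \<noteq> 1"
      using qinf_eq_0_iff[OF q_less_1] by blast
    moreover have "q * (?C / q ^ (2 * Suc j)) * q ^ (Suc j) = ?C / q ^ j"
      using q_nz by (simp add: mult_2 power_add)
    ultimately show ?thesis by simp
  qed
  obtain K1 where K1: "K1 > 0" "\<And>n. norm (qdesc \<beta> q ?a n) \<le> K1 * ?r ^ n"
    using qdesc_bounded[OF q_nz q_less_1 assms(1) nz(1) a] by blast
  obtain K2 where K2: "K2 > 0" "\<And>n. norm (qdesc \<beta> q ?b n) \<le> K2 * ?r ^ n"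
    using qdesc_bounded[OF q_nz q_less_1 assms(1) nz(2) b] by blast
  obtain K3 where K3: "K3 > 0" "\<And>k. norm (qmid \<beta> q ?C k) \<le> K3 * norm (\<beta> / q) ^ k"
    using qmid_bounded[OF q_nz q_less_1 assms(1) nz(3) C1 C2] by blast
  obtain K4 where K4: "K4 > 0" "\<And>p n. norm (qdesc \<beta> q (?C / q ^ p) n) \<le> K4 * ?r ^ n"
    using qdesc_quotient_bounded[OF q_nz q_less_1 assms(1) nz(3) C1 C0] by blast
  obtain K5 where K5: "K5 > 0" "\<And>n. norm (qbin \<beta> q n) \<le> K5"
    using qbin_bounded[OF q_less_1] by blast
  define X where "X = norm (Xcoeff \<beta> q \<mu> * Xcoeff \<beta> q \<nu>)"
  define K where "K = X * (K5 * K1 * K2 * K3 * (K5 * K4))"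
  \<comment> \<open>The two \<open>qdesc\<close> factors of \<open>Lcoeff\<close> grow like
    |q/\<beta>|^k each, and \<open>qmid\<close> cancels one of them; this yields the radius |q
    z^2/\<beta>| < 1.\<close>
  have rr: "?r ^ k * ?r ^ k * norm (\<beta> / q) ^ k = ?r ^ k" for k
    using assms(1) q_nz by (simp add: norm_divide power_divide)
  have coeff: "norm (lin_coeff \<mu> \<nu> \<beta> q k * F_coeff (\<mu> + \<nu> - 2 * of_nat k) \<beta> q m) \<le> K * ?r ^ (k + m)" for k m
  proof -
    have "norm (lin_coeff \<mu> \<nu> \<beta> q k * F_coeff (\<mu> + \<nu> - 2 * of_nat k) \<beta> q m) =
      X * (norm (qbin \<beta> q k) * norm (qdesc \<beta> q ?a k) * norm (qdesc \<beta> q ?b k) * norm (qmid \<beta> q ?C k) *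
        (norm (qbin \<beta> q m) * norm (qdesc \<beta> q (?C / q ^ (2 * k)) m)))"
      unfolding lin_F_coeff X_def Lcoeff_def Gcoeff_def by (simp only: norm_mult mult.assoc)
    also have "\<dots> \<le> X * (K5 * (K1 * ?r ^ k) * (K2 * ?r ^ k) * (K3 * norm (\<beta> / q) ^ k) * (K5 * (K4 * ?r ^ m)))"
      by (intro mult_left_mono mult_mono K1(2) K2(2) K3(2) K4(2) K5(2))
         (use K1(1) K2(1) K3(1) K4(1) K5(1) in \<open>auto simp: X_def\<close>)
    also have "\<dots> = K * (?r ^ k * ?r ^ k * norm (\<beta> / q) ^ k) * ?r ^ m"
      unfolding K_def by (simp only: mult_ac)
    also have "\<dots> = K * ?r ^ (k + m)" unfolding rr by (simp only: power_add mult.assoc)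
    finally show ?thesis .
  qed
  define D where "D = (\<lambda>k. K * norm (q * z\<^sup>2 / \<beta>) ^ k)"
  have "summable D" unfolding D_def using assms(2) by (intro summable_mult summable_geometric) simp
  moreover have "norm (lin_coeff \<mu> \<nu> \<beta> q k * z ^ (2 * k) * (F_coeff (\<mu> + \<nu> - 2 * of_nat k) \<beta> q m * z ^ (2 * m)))
       \<le> D k * norm (q * z\<^sup>2 / \<beta>) ^ m" for k m
    using term_bound[OF assms(1) coeff[of k m], of z]
    by (simp add: D_def power_add distrib_left mult_ac)
  ultimately show ?thesis using that by blast
qed

lemma sums_F:
  assumes "\<beta> \<noteq> 0" "norm (q * z\<^sup>2 / \<beta>) < 1"
  shows "(\<lambda>k. lin_coeff \<mu> \<nu> \<beta> q k * z ^ (2 * k) * F (\<mu> + \<nu> - 2 * of_nat k) z \<beta> q)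
           sums (F \<mu> z \<beta> q * F \<nu> z \<beta> q)"
proof -
  let ?T = "\<lambda>k m. lin_coeff \<mu> \<nu> \<beta> q k * z ^ (2 * k) * (F_coeff (\<mu> + \<nu> - 2 * of_nat k) \<beta> q m * z ^ (2 * m))"
  obtain D where D: "summable D" "\<And>k m. norm (?T k m) \<le> D k * norm (q * z\<^sup>2 / \<beta>) ^ m"
    using double_bound[OF assms] by blast
  have "F_summable \<mu> z \<beta> q" "F_summable \<nu> z \<beta> q"
    using F_summable_params[OF assms] by (auto simp: params_def)
  then have "(\<lambda>n. \<Sum>i\<le>n. (F_coeff \<mu> \<beta> q i * z ^ (2 * i)) * (F_coeff \<nu> \<beta> q (n - i) * z ^ (2 * (n - i))))
      sums (F \<mu> z \<beta> q * F \<nu> z \<beta> q)"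
    unfolding F_def F_summable_def by (rule Cauchy_product_sums)
  moreover have pow: "(x * z ^ (2 * i)) * (y * z ^ (2 * (n - i))) = x * y * z ^ (2 * n)"
    if "i \<le> n" for i n x y
  proof -
    have "z ^ (2 * n) = z ^ (2 * i) * z ^ (2 * (n - i))"
      unfolding power_add[symmetric] using that by (simp flip: distrib_left)
    then show ?thesis by (simp only: mult_ac)
  qed
  have "(\<Sum>i\<le>n. (F_coeff \<mu> \<beta> q i * z ^ (2 * i)) * (F_coeff \<nu> \<beta> q (n - i) * z ^ (2 * (n - i)))) =
      (\<Sum>k\<le>n. ?T k (n - k))" for n
  proof -
    have "(\<Sum>i\<le>n. (F_coeff \<mu> \<beta> q i * z ^ (2 * i)) * (F_coeff \<nu> \<beta> q (n - i) * z ^ (2 * (n - i)))) =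
      (\<Sum>i\<le>n. F_coeff \<mu> \<beta> q i * F_coeff \<nu> \<beta> q (n - i)) * z ^ (2 * n)"
      unfolding sum_distrib_right by (rule sum.cong) (auto simp: pow)
    also have "\<dots> = (\<Sum>k\<le>n. ?T k (n - k))"
      unfolding coeff_identity sum_distrib_right by (rule sum.cong) (auto simp: pow)
    finally show ?thesis .
  qed
  ultimately have "(\<lambda>n. \<Sum>k\<le>n. ?T k (n - k)) sums (F \<mu> z \<beta> q * F \<nu> z \<beta> q)" by simp
  from double_sums[OF D(2,1) _ assms(2) this]
  have s: "(\<lambda>k. \<Sum>m. ?T k m) sums (F \<mu> z \<beta> q * F \<nu> z \<beta> q)" by simp
  \<comment> \<open>For k outside \<open>inds\<close> the value of the inner series is irrelevant,
    since \<open>lin_coeff\<close> is 0 there.\<close>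
  have "(\<Sum>m. ?T k m) = lin_coeff \<mu> \<nu> \<beta> q k * z ^ (2 * k) * F (\<mu> + \<nu> - 2 * of_nat k) z \<beta> q" for k
  proof (cases "k \<in> inds")
    case True
    have "summable (\<lambda>m. F_coeff (\<mu> + \<nu> - 2 * of_nat k) \<beta> q m * z ^ (2 * m))"
      using F_summable_params[OF assms inds_params[OF True]] unfolding F_summable_def by (rule summable_norm_cancel)
    then show ?thesis unfolding F_def by (rule suminf_mult)
  next
    case False
    then show ?thesis by (simp add: lin_coeff_outside)
  qed
  with s show ?thesis by simp
qed

end

theorem theoremA6:
  fixes q \<mu> \<nu> \<beta> :: complex
  assumes "0 < norm q" and "norm q < 1"
    and "lin_defined \<mu> \<nu> \<beta> q"
  shows "((\<lambda>k. fps_const (lin_coeff \<mu> \<nu> \<beta> q k) * fps_X ^ (2 * k) * F_fps (\<mu> + \<nu> - 2 * of_nat k) \<beta> q)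
           sums (F_fps \<mu> \<beta> q * F_fps \<nu> \<beta> q)) \<and>
         (\<forall>z. \<beta> \<noteq> 0 \<and> norm (q * z\<^sup>2 / \<beta>) < 1 \<longrightarrow>
           F_summable \<mu> z \<beta> q \<and> F_summable \<nu> z \<beta> q \<and>
           (\<forall>k \<in> qrange \<mu> \<inter> qrange \<nu>. F_summable (\<mu> + \<nu> - 2 * of_nat k) z \<beta> q) \<and>
           (\<lambda>k. lin_coeff \<mu> \<nu> \<beta> q k * z ^ (2 * k) * F (\<mu> + \<nu> - 2 * of_nat k) z \<beta> q)
             sums (F \<mu> z \<beta> q * F \<nu> z \<beta> q))"
proof -
  interpret linearization q \<mu> \<nu> \<beta> by unfold_locales fact+
  show ?thesis
    using sums_fps sums_F F_summable_params by (auto simp: params_def)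
qed

end
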